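(* Let $d \ge 3$ be an integer. There exists a constant $c_d \in (0,\infty)$ depending only on $d$ such that for all integers $n \ge 1$, $$C(d,n) \le c_d\, (\log(n+1))^{d-3}.$$ In particular, $\sup_{n \ge 1} C(3,n) < \infty$.
   Context: For integers $d,n\ge 1$, $C(d,n) \in [1,\infty)$ denotes the smallest constant such that $$\|p(T)\| \le C(d,n) \sup_{z \in \mathbb{D}^d} |p(z)|$$ holds for every homogeneous polynomial $p \in \mathbb{C}[z_1,\ldots,z_d]$ of degree $n$ and every $d$-tuple $T=(T_1,\ldots,T_d)$ of commuting contractions (bounded operators of norm at most $1$) on a complex Hilbert space. Here $\mathbb{D}$ is the open unit disc in $\mathbb{C}$, and $p(T)=p(T_1,\dots,T_d)$. *)

theory Defs
  imports "HOL-Analysis.Analysis" "HOL-Algebra.Module" "HOL-Library.Poly_Mapping"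
begin

definition complex_field :: "complex ring" where
  "complex_field = \<lparr>carrier = UNIV, mult = (*), one = 1, zero = 0, add = (+)\<rparr>"

text \<open>Hilbert spaces are carrier-based, so that one can quantify over all of them inside a formula.
  A complex vector space is a module over the ring record of the complex numbers; the ring fields
  \<open>mult\<close> and \<open>one\<close> inherited by the record are not used.  The inner product is linear in its first
  argument.\<close>

record 'a inner_space = "(complex, 'a) module" +
  cinner :: "'a \<Rightarrow> 'a \<Rightarrow> complex"

definition hnorm :: "('a, 'b) inner_space_scheme \<Rightarrow> 'a \<Rightarrow> real" where
  "hnorm H x = sqrt (Re (cinner H x x))"

locale complex_hilbert_space = Module.module complex_field H for H (structure) +
  assumes cinner_add_left:
      "\<lbrakk>x \<in> carrier H; y \<in> carrier H; z \<in> carrier H\<rbrakk> \<Longrightarrow>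
        cinner H (x \<oplus>\<^bsub>H\<^esub> y) z = cinner H x z + cinner H y z"
    and cinner_smult_left:
      "\<lbrakk>x \<in> carrier H; y \<in> carrier H\<rbrakk> \<Longrightarrow> cinner H (a \<odot>\<^bsub>H\<^esub> x) y = a * cinner H x y"
    and cinner_commute:
      "\<lbrakk>x \<in> carrier H; y \<in> carrier H\<rbrakk> \<Longrightarrow> cinner H y x = cnj (cinner H x y)"
    and cinner_pos:
      "\<lbrakk>x \<in> carrier H; x \<noteq> \<zero>\<^bsub>H\<^esub>\<rbrakk> \<Longrightarrow> 0 < Re (cinner H x x)"
    and complete:
      "\<lbrakk>\<And>k. X k \<in> carrier H;
        \<forall>e>0. \<exists>N. \<forall>k\<ge>N. \<forall>l\<ge>N. hnorm H (X k \<ominus>\<^bsub>H\<^esub> X l) < e\<rbrakk> \<Longrightarrow>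
        \<exists>x\<in>carrier H. (\<lambda>k. hnorm H (X k \<ominus>\<^bsub>H\<^esub> x)) \<longlonglongrightarrow> 0"

definition bounded_operator :: "('a, 'b) inner_space_scheme \<Rightarrow> ('a \<Rightarrow> 'a) \<Rightarrow> bool" where
  "bounded_operator H A \<longleftrightarrow> A \<in> carrier H \<rightarrow> carrier H \<and>
     (\<forall>x\<in>carrier H. \<forall>y\<in>carrier H. A (x \<oplus>\<^bsub>H\<^esub> y) = A x \<oplus>\<^bsub>H\<^esub> A y) \<and>
     (\<forall>a. \<forall>x\<in>carrier H. A (a \<odot>\<^bsub>H\<^esub> x) = a \<odot>\<^bsub>H\<^esub> A x) \<and>
     (\<exists>K. \<forall>x\<in>carrier H. hnorm H (A x) \<le> K * hnorm H x)"

definition op_norm :: "('a, 'b) inner_space_scheme \<Rightarrow> ('a \<Rightarrow> 'a) \<Rightarrow> real" where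
  "op_norm H A = (SUP x\<in>{x \<in> carrier H. hnorm H x \<le> 1}. hnorm H (A x))"

definition contraction :: "('a, 'b) inner_space_scheme \<Rightarrow> ('a \<Rightarrow> 'a) \<Rightarrow> bool" where
  "contraction H A \<longleftrightarrow> bounded_operator H A \<and> op_norm H A \<le> 1"

definition commuting_contractions ::
    "('a, 'b) inner_space_scheme \<Rightarrow> nat \<Rightarrow> (nat \<Rightarrow> 'a \<Rightarrow> 'a) \<Rightarrow> bool" where
  "commuting_contractions H d T \<longleftrightarrow> (\<forall>i<d. contraction H (T i)) \<and>
     (\<forall>i<d. \<forall>j<d. \<forall>x\<in>carrier H. T i (T j x) = T j (T i x))"

text \<open>In \<open>op_norm\<close>, \<open>bounded_operator\<close> and \<open>commuting_contractions\<close> only the values on the carrier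
  matter.

  Polynomials are finitely supported coefficient families on multi-indices;
  the variables \<open>z\<^sub>1, \<dots>, z\<^sub>d\<close> carry the indices \<open>0, \<dots>, d - 1\<close>.\<close>

type_synonym cpoly = "(nat \<Rightarrow>\<^sub>0 nat) \<Rightarrow>\<^sub>0 complex"

definition homogeneous_poly :: "nat \<Rightarrow> nat \<Rightarrow> cpoly \<Rightarrow> bool" where
  "homogeneous_poly d n p \<longleftrightarrow>
     (\<forall>m \<in> Poly_Mapping.keys p. Poly_Mapping.keys m \<subseteq> {..<d} \<and> (\<Sum>i<d. Poly_Mapping.lookup m i) = n)"

definition poly_eval :: "nat \<Rightarrow> cpoly \<Rightarrow> (nat \<Rightarrow> complex) \<Rightarrow> complex" where
  "poly_eval d p z = (\<Sum>m\<in>Poly_Mapping.keys p. Poly_Mapping.lookup p m * (\<Prod>i<d. z i ^ Poly_Mapping.lookup m i))"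

text \<open>\<open>monomial_op T m d\<close> is \<open>T\<^sub>1 ^ m\<^sub>1 \<cdots> T\<^sub>d ^ m\<^sub>d\<close>.\<close>

primrec monomial_op :: "(nat \<Rightarrow> 'a \<Rightarrow> 'a) \<Rightarrow> (nat \<Rightarrow>\<^sub>0 nat) \<Rightarrow> nat \<Rightarrow> 'a \<Rightarrow> 'a" where
  "monomial_op T m 0 = id"
| "monomial_op T m (Suc d) = (T d ^^ Poly_Mapping.lookup m d) \<circ> monomial_op T m d"

definition poly_op ::
    "('a, 'b) inner_space_scheme \<Rightarrow> nat \<Rightarrow> cpoly \<Rightarrow> (nat \<Rightarrow> 'a \<Rightarrow> 'a) \<Rightarrow> 'a \<Rightarrow> 'a" where
  "poly_op H d p T x = (\<Oplus>\<^bsub>H\<^esub> m\<in>Poly_Mapping.keys p. Poly_Mapping.lookup p m \<odot>\<^bsub>H\<^esub> monomial_op T m d x)"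

definition polydisc :: "nat \<Rightarrow> (nat \<Rightarrow> complex) set" where
  "polydisc d = {..<d} \<rightarrow>\<^sub>E ball 0 1"

definition polydisc_norm :: "nat \<Rightarrow> cpoly \<Rightarrow> real" where
  "polydisc_norm d p = (SUP z\<in>polydisc d. cmod (poly_eval d p z))"

text \<open>\<open>vN_constant TYPE('a) d n K\<close>: the inequality holds with constant \<open>K\<close> for all Hilbert spaces whose
  carrier is a subset of \<open>'a\<close>.\<close>

definition vN_constant :: "'a itself \<Rightarrow> nat \<Rightarrow> nat \<Rightarrow> real \<Rightarrow> bool" where
  "vN_constant (_ :: 'a itself) d n K \<longleftrightarrow>
     (\<forall>(H :: 'a inner_space) T p. complex_hilbert_space H \<longrightarrow>
        commuting_contractions H d T \<longrightarrow> homogeneous_poly d n p \<longrightarrow>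
        op_norm H (poly_op H d p T) \<le> K * polydisc_norm d p)"

text \<open>HOL cannot quantify over types inside a definition.  Carriers in \<open>nat set\<close> suffice: theorem
  \<open>vN_constant_universal\<close> below shows that a constant valid for them is valid for
  all Hilbert spaces over every type.  For \<open>d \<ge> 1\<close>, the infimum is the smallest such constant
  and is at least 1: see \<open>vN_C_constant\<close>, \<open>vN_C_least\<close>, \<open>vN_C_ge_1\<close>.\<close>

definition vN_C :: "nat \<Rightarrow> nat \<Rightarrow> real" where
  "vN_C d n = Inf {K. vN_constant TYPE(nat set) d n K}"

subsection \<open>Adequacy of the definition of \<open>vN_C\<close>\<close>

lemma complex_field_simps [simp]:
  "carrier complex_field = UNIV" "a \<otimes>\<^bsub>complex_field\<^esub> b = a * b" "\<one>\<^bsub>complex_field\<^esub> = 1"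
  "\<zero>\<^bsub>complex_field\<^esub> = 0" "a \<oplus>\<^bsub>complex_field\<^esub> b = a + b"
  by (simp_all add: complex_field_def)

lemma cring_complex_field: "cring complex_field"
proof (intro cringI abelian_groupI comm_monoidI)
  show "\<exists>y\<in>carrier complex_field. y \<oplus>\<^bsub>complex_field\<^esub> x = \<zero>\<^bsub>complex_field\<^esub>" for x
    by (auto intro: exI[of _ "- x"])
qed (auto simp: algebra_simps)

interpretation CF: cring complex_field
  by (rule cring_complex_field)

lemma complex_field_minus [simp]: "\<ominus>\<^bsub>complex_field\<^esub> a = - a"
  using CF.minus_equality[of "- a" a] by simp

context complex_hilbert_space
begin

lemma one_smult [simp]: "x \<in> carrier H \<Longrightarrow> 1 \<odot> x = x"
  using smult_one[of x] unfolding complex_field_simps .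

lemma zero_smult [simp]: "x \<in> carrier H \<Longrightarrow> 0 \<odot> x = \<zero>"
  using smult_l_null[of x] unfolding complex_field_simps .

lemma minus_eq: "\<lbrakk>x \<in> carrier H; y \<in> carrier H\<rbrakk> \<Longrightarrow> x \<ominus> y = x \<oplus> (-1) \<odot> y"
  using smult_l_minus[of 1 y] by (simp add: M.minus_eq del: smult_one)

lemma diff_closed [simp, intro]: "\<lbrakk>x \<in> carrier H; y \<in> carrier H\<rbrakk> \<Longrightarrow> x \<ominus> y \<in> carrier H"
  by (simp add: minus_eq)

lemma smult_in [simp, intro]: "x \<in> carrier H \<Longrightarrow> a \<odot> x \<in> carrier H"
  by (rule smult_closed) auto

lemma cinner_add_right:
  assumes "x \<in> carrier H" "y \<in> carrier H" "z \<in> carrier H"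
  shows "cinner H z (x \<oplus> y) = cinner H z x + cinner H z y"
  using assms cinner_commute[of "x \<oplus> y" z] cinner_commute[of x z] cinner_commute[of y z]
  by (simp add: cinner_add_left)

lemma cinner_smult_right:
  assumes "x \<in> carrier H" "y \<in> carrier H"
  shows "cinner H x (a \<odot> y) = cnj a * cinner H x y"
  using assms cinner_commute[of "a \<odot> y" x] cinner_commute[of y x]
  by (simp add: cinner_smult_left)

lemma cinner_zero_left [simp]: "x \<in> carrier H \<Longrightarrow> cinner H \<zero> x = 0"
  using cinner_add_left[of \<zero> \<zero> x] by simp

lemma hnorm_zero [simp]: "hnorm H \<zero> = 0"
  by (simp add: hnorm_def)

lemma cinner_self: "x \<in> carrier H \<Longrightarrow> cinner H x x = complex_of_real ((hnorm H x)\<^sup>2)"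
  using cinner_commute[of x x] cinner_pos[of x]
  by (cases "x = \<zero>") (auto simp: hnorm_def complex_eq_iff)

lemma hnorm_nonneg [simp]: "x \<in> carrier H \<Longrightarrow> 0 \<le> hnorm H x"
  using cinner_pos[of x] by (cases "x = \<zero>") (auto simp: hnorm_def)

lemma hnorm_eq_0 [simp]: "x \<in> carrier H \<Longrightarrow> hnorm H x = 0 \<longleftrightarrow> x = \<zero>"
  using cinner_pos[of x] by (cases "x = \<zero>") (auto simp: hnorm_def)

lemma hnorm_smult [simp]:
  assumes "x \<in> carrier H" shows "hnorm H (a \<odot> x) = cmod a * hnorm H x"
proof -
  have "cinner H (a \<odot> x) (a \<odot> x) = complex_of_real ((cmod a)\<^sup>2 * (hnorm H x)\<^sup>2)"
    using assms cinner_self[OF assms]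
    by (simp add: cinner_smult_left cinner_smult_right complex_norm_square del: of_real_power)
  then have "hnorm H (a \<odot> x) = sqrt ((cmod a * hnorm H x)\<^sup>2)"
    by (simp add: hnorm_def power_mult_distrib)
  then show ?thesis using assms by simp
qed

lemma Cauchy_Schwarz:
  assumes x: "x \<in> carrier H" and y: "y \<in> carrier H"
  shows "cmod (cinner H x y) \<le> hnorm H x * hnorm H y"
proof (cases "y = \<zero>")
  case True
  then show ?thesis using x cinner_commute[of \<zero> x] by simp
next
  case False
  define s where "s = (hnorm H y)\<^sup>2"
  define c where "c = cinner H x y"
  have s: "s > 0" using False y by (simp add: s_def)
  let ?w = "of_real s \<odot> x \<oplus> (- c) \<odot> y"
  have "cinner H ?w ?w = of_real s * of_real s * cinner H x x - of_real s * cnj c * c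
      - c * of_real s * cnj c + c * cnj c * of_real s"
    using x y cinner_commute[of x y]
    by (simp add: cinner_add_left cinner_add_right cinner_smult_left cinner_smult_right
        cinner_self[OF y] c_def s_def algebra_simps)
  also have "\<dots> = of_real (s * (s * (hnorm H x)\<^sup>2 - (cmod c)\<^sup>2))"
    using x by (simp add: cinner_self complex_norm_square algebra_simps del: of_real_power)
  finally have "Re (cinner H ?w ?w) = s * (s * (hnorm H x)\<^sup>2 - (cmod c)\<^sup>2)"
    by simp
  moreover have "Re (cinner H ?w ?w) \<ge> 0"
    using x y by (subst cinner_self) auto
  ultimately have "(cmod c)\<^sup>2 \<le> s * (hnorm H x)\<^sup>2"
    using s by (simp add: zero_le_mult_iff)
  then have "(cmod c)\<^sup>2 \<le> (hnorm H x * hnorm H y)\<^sup>2"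
    by (simp add: s_def power_mult_distrib mult.commute)
  then show ?thesis using x y by (simp add: c_def power2_le_iff_abs_le)
qed

lemma hnorm_triangle:
  assumes x: "x \<in> carrier H" and y: "y \<in> carrier H"
  shows "hnorm H (x \<oplus> y) \<le> hnorm H x + hnorm H y"
proof -
  have "complex_of_real ((hnorm H (x \<oplus> y))\<^sup>2)
      = of_real ((hnorm H x)\<^sup>2 + (hnorm H y)\<^sup>2) + (cinner H x y + cnj (cinner H x y))"
    using x y cinner_commute[OF x y]
    by (simp add: cinner_self[symmetric] cinner_add_left cinner_add_right del: of_real_power)
  also have "\<dots> = complex_of_real ((hnorm H x)\<^sup>2 + (hnorm H y)\<^sup>2 + 2 * Re (cinner H x y))"
    by (simp add: complex_eq_iff)
  finally have "(hnorm H (x \<oplus> y))\<^sup>2 = (hnorm H x)\<^sup>2 + (hnorm H y)\<^sup>2 + 2 * Re (cinner H x y)"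
    using of_real_eq_iff by blast
  also have "\<dots> \<le> (hnorm H x)\<^sup>2 + (hnorm H y)\<^sup>2 + 2 * (hnorm H x * hnorm H y)"
    using Cauchy_Schwarz[OF x y] complex_Re_le_cmod[of "cinner H x y"] by linarith
  finally have "(hnorm H (x \<oplus> y))\<^sup>2 \<le> (hnorm H x + hnorm H y)\<^sup>2"
    by (simp add: power2_sum)
  then show ?thesis using x y by (simp add: power2_le_iff_abs_le)
qed

lemma hnorm_minus_commute:
  assumes x: "x \<in> carrier H" and y: "y \<in> carrier H"
  shows "hnorm H (x \<ominus> y) = hnorm H (y \<ominus> x)"
proof -
  have "y \<ominus> x = (-1) \<odot> (x \<ominus> y)"
    using x y smult_assoc1[of "-1" "-1" y, symmetric]
    by (simp add: minus_eq smult_r_distr M.add.m_comm)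
  then show ?thesis using x y by simp
qed

lemma diff_triangle:
  assumes "x \<in> carrier H" "y \<in> carrier H" "z \<in> carrier H"
  shows "x \<ominus> z = (x \<ominus> y) \<oplus> (y \<ominus> z)"
  using assms by (simp add: M.minus_eq M.a_assoc M.r_neg1 M.r_neg2 M.a_lcomm M.r_neg M.l_neg)

lemma diff_eq_0: "\<lbrakk>x \<in> carrier H; y \<in> carrier H\<rbrakk> \<Longrightarrow> x \<ominus> y = \<zero> \<longleftrightarrow> x = y"
  by (metis M.minus_eq M.minus_minus M.a_inv_closed M.minus_equality M.r_neg)

lemma hnorm_diff_triangle:
  assumes "x \<in> carrier H" "y \<in> carrier H" "z \<in> carrier H"
  shows "hnorm H (x \<ominus> z) \<le> hnorm H (x \<ominus> y) + hnorm H (y \<ominus> z)"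
  using assms hnorm_triangle[of "x \<ominus> y" "y \<ominus> z"] diff_triangle[of x y z] by simp

end


context complex_hilbert_space
begin

definition linear_contraction :: "('a \<Rightarrow> 'a) \<Rightarrow> bool" where
  "linear_contraction A \<longleftrightarrow> A \<in> carrier H \<rightarrow> carrier H \<and>
     (\<forall>x\<in>carrier H. \<forall>y\<in>carrier H. A (x \<oplus> y) = A x \<oplus> A y) \<and>
     (\<forall>a. \<forall>x\<in>carrier H. A (a \<odot> x) = a \<odot> A x) \<and>
     (\<forall>x\<in>carrier H. hnorm H (A x) \<le> hnorm H x)"

lemma op_norm_le:
  assumes "\<And>x. \<lbrakk>x \<in> carrier H; hnorm H x \<le> 1\<rbrakk> \<Longrightarrow> hnorm H (A x) \<le> c"
  shows "op_norm H A \<le> c"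
  unfolding op_norm_def using assms M.zero_closed by (intro cSUP_least) (auto intro!: exI[of _ \<zero>])

lemma op_norm_bound:
  assumes "\<And>x. x \<in> carrier H \<Longrightarrow> hnorm H (A x) \<le> K * hnorm H x"
    and "x \<in> carrier H" "hnorm H x \<le> 1"
  shows "hnorm H (A x) \<le> op_norm H A"
  unfolding op_norm_def
proof (intro cSUP_upper bdd_aboveI2)
  fix y assume y: "y \<in> {x \<in> carrier H. hnorm H x \<le> 1}"
  have "hnorm H (A y) \<le> K * hnorm H y" using assms(1) y by auto
  also have "\<dots> \<le> \<bar>K\<bar> * 1" using y by (intro mult_mono) auto
  finally show "hnorm H (A y) \<le> \<bar>K\<bar>" by simp
qed (use assms in auto)

lemma contraction_iff: "contraction H A \<longleftrightarrow> linear_contraction A"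
proof
  assume A: "contraction H A"
  then have bd: "bounded_operator H A" and le: "op_norm H A \<le> 1"
    by (auto simp: contraction_def)
  obtain K where K: "\<And>x. x \<in> carrier H \<Longrightarrow> hnorm H (A x) \<le> K * hnorm H x"
    using bd unfolding bounded_operator_def by blast
  have "hnorm H (A x) \<le> hnorm H x" if x: "x \<in> carrier H" for x
  proof (cases "x = \<zero>")
    case True
    then show ?thesis using K[of \<zero>] by simp
  next
    case False
    then have pos: "hnorm H x > 0" using x hnorm_nonneg[of x] hnorm_eq_0[of x] by linarith
    let ?y = "of_real (1 / hnorm H x) \<odot> x"
    have "hnorm H (A ?y) \<le> op_norm H A"
      using x pos by (intro op_norm_bound[OF K]) (auto simp del: of_real_divide)
    also have "A ?y = of_real (1 / hnorm H x) \<odot> A x"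
      using bd x by (auto simp: bounded_operator_def)
    also have "hnorm H \<dots> = hnorm H (A x) / hnorm H x"
      using bd x pos by (subst hnorm_smult) (auto simp: bounded_operator_def simp del: of_real_divide)
    finally have "hnorm H (A x) / hnorm H x \<le> 1" using le by linarith
    then show ?thesis using pos by simp
  qed
  then show "linear_contraction A"
    using bd by (auto simp: bounded_operator_def linear_contraction_def)
next
  assume A: "linear_contraction A"
  then have "op_norm H A \<le> 1"
    by (intro op_norm_le) (force simp: linear_contraction_def)
  moreover have "bounded_operator H A"
    using A unfolding linear_contraction_def bounded_operator_def
    by (metis mult_1)
  ultimately show "contraction H A" by (simp add: contraction_def)
qed

lemma linear_contractionD:
  assumes "linear_contraction A"
  shows "x \<in> carrier H \<Longrightarrow> A x \<in> carrier H"
    and "\<lbrakk>x \<in> carrier H; y \<in> carrier H\<rbrakk> \<Longrightarrow> A (x \<oplus> y) = A x \<oplus> A y"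
    and "x \<in> carrier H \<Longrightarrow> A (a \<odot> x) = a \<odot> A x"
    and "x \<in> carrier H \<Longrightarrow> hnorm H (A x) \<le> hnorm H x"
  using assms by (auto simp: linear_contraction_def)

lemma linear_contraction_diff:
  assumes "linear_contraction A" "x \<in> carrier H" "y \<in> carrier H"
  shows "A (x \<ominus> y) = A x \<ominus> A y"
  using assms by (simp add: minus_eq linear_contractionD)

lemma linear_contraction_comp:
  "\<lbrakk>linear_contraction A; linear_contraction B\<rbrakk> \<Longrightarrow> linear_contraction (A \<circ> B)"
  unfolding linear_contraction_def by (auto 0 3 simp: Pi_iff intro: order_trans)

lemma linear_contraction_id: "linear_contraction id"
  by (simp add: linear_contraction_def)

lemma linear_contraction_funpow: "linear_contraction A \<Longrightarrow> linear_contraction (A ^^ k)"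
  by (induction k) (auto intro: linear_contraction_comp linear_contraction_id)

lemma linear_contraction_monomial:
  "(\<And>i. i < d \<Longrightarrow> linear_contraction (T i)) \<Longrightarrow> linear_contraction (monomial_op T m d)"
proof (induction d)
  case (Suc d)
  then show ?case
    unfolding monomial_op.simps by (intro linear_contraction_comp linear_contraction_funpow) auto
qed (simp add: linear_contraction_id)

lemma hnorm_finsum:
  assumes "finite A" "\<And>i. i \<in> A \<Longrightarrow> f i \<in> carrier H"
  shows "hnorm H (finsum H f A) \<le> (\<Sum>i\<in>A. hnorm H (f i))"
  using assms
proof (induction A rule: finite_induct)
  case (insert i A)
  have "finsum H f (insert i A) = f i \<oplus> finsum H f A"
    using insert by (intro M.finsum_insert) auto
  also have "hnorm H \<dots> \<le> hnorm H (f i) + hnorm H (finsum H f A)"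
    using insert by (intro hnorm_triangle M.finsum_closed) auto
  finally show ?case using insert by auto
qed simp

lemma poly_op_bound:
  assumes T: "commuting_contractions H d T" and x: "x \<in> carrier H"
  shows "poly_op H d p T x \<in> carrier H"
    and "hnorm H (poly_op H d p T x)
      \<le> (\<Sum>m\<in>Poly_Mapping.keys p. cmod (Poly_Mapping.lookup p m)) * hnorm H x"
proof -
  have lin: "linear_contraction (monomial_op T m d)" for m
    using T by (intro linear_contraction_monomial)
      (auto simp: commuting_contractions_def contraction_iff)
  note D = linear_contractionD[OF lin]
  show "poly_op H d p T x \<in> carrier H"
    unfolding poly_op_def using D(1) x by (intro M.finsum_closed) auto
  have "hnorm H (poly_op H d p T x)
      \<le> (\<Sum>m\<in>Poly_Mapping.keys p. hnorm H (Poly_Mapping.lookup p m \<odot> monomial_op T m d x))"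
    unfolding poly_op_def using D(1) x by (intro hnorm_finsum) auto
  also have "\<dots> \<le> (\<Sum>m\<in>Poly_Mapping.keys p. cmod (Poly_Mapping.lookup p m) * hnorm H x)"
    using D(1,4) x by (intro sum_mono) (auto intro!: mult_left_mono)
  finally show "hnorm H (poly_op H d p T x)
      \<le> (\<Sum>m\<in>Poly_Mapping.keys p. cmod (Poly_Mapping.lookup p m)) * hnorm H x"
    by (simp add: sum_distrib_right)
qed

end

text \<open>Transport of a closed subspace to another type along an injection.\<close>

locale hilbert_subspace = complex_hilbert_space +
  fixes M :: "'a set" and f :: "'a \<Rightarrow> 'c"
  assumes M_sub: "M \<subseteq> carrier H"
    and M_zero: "\<zero> \<in> M"
    and M_add: "\<lbrakk>x \<in> M; y \<in> M\<rbrakk> \<Longrightarrow> x \<oplus> y \<in> M"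
    and M_smult: "x \<in> M \<Longrightarrow> a \<odot> x \<in> M"
    and M_closed: "\<lbrakk>x \<in> carrier H; \<And>e. e > 0 \<Longrightarrow> \<exists>y\<in>M. hnorm H (x \<ominus> y) < e\<rbrakk> \<Longrightarrow> x \<in> M"
    and f_inj: "inj_on f M"
begin

definition g where "g = inv_into M f"

definition H' :: "'c inner_space" where
  "H' = \<lparr>carrier = f ` M, mult = \<lambda>a b. a, one = f \<zero>, zero = f \<zero>, add = \<lambda>a b. f (g a \<oplus> g b),
     smult = \<lambda>c a. f (c \<odot> g a), cinner = \<lambda>a b. cinner H (g a) (g b)\<rparr>"

lemma gf [simp]: "x \<in> M \<Longrightarrow> g (f x) = x"
  using f_inj by (simp add: g_def)

lemma MD [simp]: "x \<in> M \<Longrightarrow> x \<in> carrier H"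
  using M_sub by auto

lemma H'_simps [simp]:
  "carrier H' = f ` M" "\<zero>\<^bsub>H'\<^esub> = f \<zero>"
  "a \<oplus>\<^bsub>H'\<^esub> b = f (g a \<oplus> g b)" "c \<odot>\<^bsub>H'\<^esub> a = f (c \<odot> g a)"
  "cinner H' a b = cinner H (g a) (g b)" "hnorm H' a = hnorm H (g a)"
  by (simp_all add: H'_def hnorm_def)

lemma module_H': "Module.module complex_field H'"
proof (intro moduleI cring_complex_field abelian_groupI)
  fix a assume "a \<in> carrier H'"
  then obtain x where x: "x \<in> M" "a = f x" by auto
  then have "(-1) \<odot> x \<oplus> x = \<zero>"
    using smult_l_distr[of "-1" 1 x] by simp
  then show "\<exists>y\<in>carrier H'. y \<oplus>\<^bsub>H'\<^esub> a = \<zero>\<^bsub>H'\<^esub>"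
    using x by (intro bexI[of _ "f ((-1) \<odot> x)"]) (simp_all add: M_smult)
qed (auto simp: M_add M_smult M_zero M.a_ac smult_r_distr
      smult_assoc1[unfolded complex_field_simps, OF UNIV_I UNIV_I]
      smult_l_distr[unfolded complex_field_simps, OF UNIV_I UNIV_I])

lemma M_diff: "\<lbrakk>x \<in> M; y \<in> M\<rbrakk> \<Longrightarrow> x \<ominus> y \<in> M"
  by (simp add: minus_eq M_add M_smult)

lemma H'_diff:
  assumes "x \<in> M" "y \<in> M"
  shows "f x \<ominus>\<^bsub>H'\<^esub> f y = f (x \<ominus> y)"
proof -
  interpret H': Module.module complex_field H' by (rule module_H')
  have "(-1) \<odot> y \<oplus> y = \<zero>"
    using smult_l_distr[of "-1" 1 y] assms by simp
  then have "\<ominus>\<^bsub>H'\<^esub> (f y) = f ((-1) \<odot> y)"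
    using assms by (intro H'.M.minus_equality) (auto simp: M_smult)
  then show ?thesis
    using assms by (simp add: a_minus_def[of H'] M_smult minus_eq)
qed

lemma hilbert_H': "complex_hilbert_space H'"
proof (intro complex_hilbert_space.intro module_H' complex_hilbert_space_axioms.intro)
  fix X :: "nat \<Rightarrow> 'c"
  assume X: "\<And>k. X k \<in> carrier H'"
    and cau: "\<forall>e>0. \<exists>N. \<forall>k\<ge>N. \<forall>l\<ge>N. hnorm H' (X k \<ominus>\<^bsub>H'\<^esub> X l) < e"
  define Y where "Y = g \<circ> X"
  have Y: "Y k \<in> M" "X k = f (Y k)" for k
    using X[of k] by (auto simp: Y_def)
  have "\<exists>x\<in>carrier H. (\<lambda>k. hnorm H (Y k \<ominus> x)) \<longlonglongrightarrow> 0"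
    using cau Y by (intro complete) (auto simp: H'_diff M_diff)
  then obtain x where x: "x \<in> carrier H" and lim: "(\<lambda>k. hnorm H (Y k \<ominus> x)) \<longlonglongrightarrow> 0"
    by auto
  have "x \<in> M"
  proof (rule M_closed[OF x])
    fix e :: real assume "e > 0"
    then have "eventually (\<lambda>k. hnorm H (Y k \<ominus> x) < e) sequentially"
      using lim by (rule order_tendstoD(2)[rotated])
    then obtain k where "hnorm H (Y k \<ominus> x) < e"
      by (auto simp: eventually_sequentially)
    then show "\<exists>y\<in>M. hnorm H (x \<ominus> y) < e"
      using x Y(1)[of k] hnorm_minus_commute[of "Y k" x] by (intro bexI[of _ "Y k"]) auto
  qed
  then show "\<exists>x\<in>carrier H'. (\<lambda>k. hnorm H' (X k \<ominus>\<^bsub>H'\<^esub> x)) \<longlonglongrightarrow> 0"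
    using lim Y by (intro bexI[of _ "f x"]) (auto simp: H'_diff M_diff)
next
  fix x y assume "x \<in> carrier H'" "y \<in> carrier H'"
  then show "cinner H' y x = cnj (cinner H' x y)"
    using cinner_commute[of "g x" "g y"] by auto
next
  fix a assume "a \<in> carrier H'" "a \<noteq> \<zero>\<^bsub>H'\<^esub>"
  then show "0 < Re (cinner H' a a)"
    using cinner_pos[of "g a"] by fastforce
qed (auto simp: cinner_add_left cinner_smult_left M_add M_smult)

sublocale H': complex_hilbert_space H'
  by (rule hilbert_H')

lemma H'_finsum:
  assumes "finite A" "\<And>i. i \<in> A \<Longrightarrow> h i \<in> M"
  shows "finsum H h A \<in> M \<and> (\<Oplus>\<^bsub>H'\<^esub>i\<in>A. f (h i)) = f (finsum H h A)"
  using assms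
proof (induction A rule: finite_induct)
  case empty
  show ?case using M_zero H'.M.finsum_empty by simp
next
  case (insert i A)
  have "(\<Oplus>\<^bsub>H'\<^esub>i\<in>insert i A. f (h i)) = f (h i) \<oplus>\<^bsub>H'\<^esub> (\<Oplus>\<^bsub>H'\<^esub>i\<in>A. f (h i))"
    using insert by (intro H'.M.finsum_insert) auto
  moreover have "finsum H h (insert i A) = h i \<oplus> finsum H h A"
    using insert by (intro M.finsum_insert) auto
  ultimately show ?case using insert M_add by auto
qed

context
  fixes d :: nat and T :: "nat \<Rightarrow> 'a \<Rightarrow> 'a"
  assumes T: "commuting_contractions H d T" and TM: "\<And>i x. \<lbrakk>i < d; x \<in> M\<rbrakk> \<Longrightarrow> T i x \<in> M"
begin

definition T' where "T' i a = f (T i (g a))"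

lemma T'_commuting: "commuting_contractions H' d T'"
proof -
  have lin: "linear_contraction (T i)" if "i < d" for i
    using T that by (auto simp: commuting_contractions_def contraction_iff)
  have "H'.linear_contraction (T' i)" if "i < d" for i
    unfolding H'.linear_contraction_def
    using linear_contractionD[OF lin[OF that]] TM[OF that]
    by (auto simp: T'_def M_add M_smult)
  moreover have "T' i (T' j a) = T' j (T' i a)" if "i < d" "j < d" "a \<in> carrier H'" for i j a
    using that T TM by (auto simp: T'_def commuting_contractions_def)
  ultimately show ?thesis
    by (auto simp: commuting_contractions_def H'.contraction_iff)
qed

lemma funpow_T': "i < d \<Longrightarrow> x \<in> M \<Longrightarrow> (T i ^^ k) x \<in> M \<and> (T' i ^^ k) (f x) = f ((T i ^^ k) x)"
  by (induction k) (auto simp: T'_def TM)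

lemma monomial_T':
  "e \<le> d \<Longrightarrow> x \<in> M \<Longrightarrow>
    monomial_op T m e x \<in> M \<and> monomial_op T' m e (f x) = f (monomial_op T m e x)"
  by (induction e) (auto simp: funpow_T')

lemma poly_T':
  assumes "x \<in> M"
  shows "poly_op H d p T x \<in> M \<and> poly_op H' d p T' (f x) = f (poly_op H d p T x)"
proof -
  have "poly_op H' d p T' (f x)
      = (\<Oplus>\<^bsub>H'\<^esub>m\<in>Poly_Mapping.keys p. f (Poly_Mapping.lookup p m \<odot> monomial_op T m d x))"
    unfolding poly_op_def using assms monomial_T'[of d x]
    by (intro H'.M.finsum_cong') (auto simp: M_smult)
  then show ?thesis
    unfolding poly_op_def
    using H'_finsum[of "Poly_Mapping.keys p" "\<lambda>m. Poly_Mapping.lookup p m \<odot> monomial_op T m d x"]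
      assms monomial_T'[of d x] by (auto simp: M_smult)
qed

end

end

text \<open>The closed subspace spanned by the orbit of one vector under finitely many contractions is
  the closure of the countable set of values of the following terms (with scalars in
  \<open>\<rat> + i\<rat>\<close>), hence a vector in it is determined by a set of natural numbers.\<close>

datatype gen = Gen_Base | Gen_Plus gen gen | Gen_Scale rat rat gen | Gen_Apply nat gen

instance gen :: countable
  by countable_datatype

context complex_hilbert_space
begin

primrec gen_eval :: "nat \<Rightarrow> (nat \<Rightarrow> 'a \<Rightarrow> 'a) \<Rightarrow> 'a \<Rightarrow> gen \<Rightarrow> 'a" where
  "gen_eval d T x Gen_Base = x"
| "gen_eval d T x (Gen_Plus s t) = gen_eval d T x s \<oplus> gen_eval d T x t"
| "gen_eval d T x (Gen_Scale q r t) = Complex (of_rat q) (of_rat r) \<odot> gen_eval d T x t"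
| "gen_eval d T x (Gen_Apply i t) = (if i < d then T i (gen_eval d T x t) else x)"

definition cyclic :: "nat \<Rightarrow> (nat \<Rightarrow> 'a \<Rightarrow> 'a) \<Rightarrow> 'a \<Rightarrow> 'a set" where
  "cyclic d T x = {y \<in> carrier H. \<forall>e>0. \<exists>t. hnorm H (y \<ominus> gen_eval d T x t) < e}"

definition code :: "nat \<Rightarrow> (nat \<Rightarrow> 'a \<Rightarrow> 'a) \<Rightarrow> 'a \<Rightarrow> 'a \<Rightarrow> nat set" where
  "code d T x y =
    {to_nat (t, k) | t k. hnorm H (y \<ominus> gen_eval d T x t) < 1 / real (Suc k)}"

lemma half_eps:
  fixes c e :: real assumes "c \<ge> 0" "e > 0"
  shows "e / (2 * (c + 1)) > 0" "c * (e / (2 * (c + 1))) < e / 2"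
proof -
  have "c + 1 > 0" using assms by simp
  then show "e / (2 * (c + 1)) > 0" "c * (e / (2 * (c + 1))) < e / 2"
    using assms by (auto simp: field_simps)
qed

lemma complex_rat_approx:
  fixes a :: complex and e :: real assumes "e > 0"
  shows "\<exists>q r. cmod (a - Complex (of_rat q) (of_rat r)) < e"
proof -
  obtain q where q: "Re a - e/2 < of_rat q" "of_rat q < Re a"
    using of_rat_dense[of "Re a - e/2" "Re a"] assms by auto
  obtain r where r: "Im a - e/2 < of_rat r" "of_rat r < Im a"
    using of_rat_dense[of "Im a - e/2" "Im a"] assms by auto
  have "cmod (a - Complex (of_rat q) (of_rat r)) \<le> \<bar>Re a - of_rat q\<bar> + \<bar>Im a - of_rat r\<bar>"
    using cmod_le[of "a - Complex (of_rat q) (of_rat r)"] by simp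
  then show ?thesis using q r by (intro exI[of _ q] exI[of _ r]) linarith
qed

lemma cyclic_subspace:
  assumes T: "commuting_contractions H d T" and x: "x \<in> carrier H"
  shows "hilbert_subspace H (cyclic d T x) (code d T x)"
    and "\<And>i y. \<lbrakk>i < d; y \<in> cyclic d T x\<rbrakk> \<Longrightarrow> T i y \<in> cyclic d T x"
    and "x \<in> cyclic d T x"
proof -
  let ?g = "gen_eval d T x" and ?M = "cyclic d T x"
  have lin: "linear_contraction (T i)" if "i < d" for i
    using T that by (auto simp: commuting_contractions_def contraction_iff)
  have g [simp]: "?g t \<in> carrier H" for t
    by (induction t) (use x linear_contractionD(1)[OF lin] in auto)
  have gM: "?g t \<in> ?M" for t
    unfolding cyclic_def using diff_eq_0[OF g g, of t t] by (auto intro!: exI[of _ t])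
  have Mc [simp]: "y \<in> ?M \<Longrightarrow> y \<in> carrier H" for y
    by (simp add: cyclic_def)
  have approx: "\<exists>t. hnorm H (y \<ominus> ?g t) < e" if "y \<in> ?M" "e > 0" for y e
    using that unfolding cyclic_def by blast
  show "x \<in> ?M" using gM[of Gen_Base] by simp
  show "T i y \<in> ?M" if i: "i < d" and y: "y \<in> ?M" for i y
    unfolding cyclic_def
  proof (intro CollectI conjI allI impI)
    show "T i y \<in> carrier H" using linear_contractionD(1)[OF lin[OF i]] y by simp
    fix e :: real assume "e > 0"
    then obtain t where t: "hnorm H (y \<ominus> ?g t) < e" using approx[OF y] by auto
    have "hnorm H (T i y \<ominus> ?g (Gen_Apply i t)) = hnorm H (T i (y \<ominus> ?g t))"
      using i y by (simp add: linear_contraction_diff[OF lin])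
    also have "\<dots> \<le> hnorm H (y \<ominus> ?g t)"
      using y by (intro linear_contractionD(4)[OF lin[OF i]]) auto
    finally show "\<exists>t. hnorm H (T i y \<ominus> ?g t) < e" using t by (meson le_less_trans)
  qed
  have closed: "y \<in> ?M"
    if y: "y \<in> carrier H" and ex: "\<And>e. e > 0 \<Longrightarrow> \<exists>z\<in>?M. hnorm H (y \<ominus> z) < e" for y
    unfolding cyclic_def
  proof (intro CollectI conjI allI impI y)
    fix e :: real assume "e > 0"
    then obtain z where z: "z \<in> ?M" "hnorm H (y \<ominus> z) < e/2" using ex[of "e/2"] by auto
    then obtain t where "hnorm H (z \<ominus> ?g t) < e/2" using approx[of z "e/2"] \<open>e > 0\<close> by auto
    then show "\<exists>t. hnorm H (y \<ominus> ?g t) < e"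
      using z hnorm_diff_triangle[of y z "?g t"] y by (intro exI[of _ t]) auto
  qed
  have add: "y \<oplus> z \<in> ?M" if y: "y \<in> ?M" and z: "z \<in> ?M" for y z
    unfolding cyclic_def
  proof (intro CollectI conjI allI impI)
    show "y \<oplus> z \<in> carrier H" using y z by simp
    fix e :: real assume "e > 0"
    then obtain s t where st: "hnorm H (y \<ominus> ?g s) < e/2" "hnorm H (z \<ominus> ?g t) < e/2"
      using approx[OF y, of "e/2"] approx[OF z, of "e/2"] by auto
    have "(y \<oplus> z) \<ominus> ?g (Gen_Plus s t) = (y \<ominus> ?g s) \<oplus> (z \<ominus> ?g t)"
      using y z by (simp add: minus_eq smult_r_distr M.a_ac)
    then show "\<exists>t. hnorm H (y \<oplus> z \<ominus> ?g t) < e"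
      using st y z hnorm_triangle[of "y \<ominus> ?g s" "z \<ominus> ?g t"]
      by (intro exI[of _ "Gen_Plus s t"]) auto
  qed
  have smult: "a \<odot> y \<in> ?M" if y: "y \<in> ?M" for a y
    unfolding cyclic_def
  proof (intro CollectI conjI allI impI)
    show "a \<odot> y \<in> carrier H" using y by simp
    fix e :: real assume e: "e > 0"
    have nn: "hnorm H y \<ge> 0" using y by simp
    define e1 where "e1 = e / (2 * (hnorm H y + 1))"
    have e1: "e1 > 0" "e1 * hnorm H y < e / 2"
      using half_eps[OF nn e] by (simp_all add: e1_def mult.commute)
    obtain q r where qr: "cmod (a - Complex (of_rat q) (of_rat r)) < e1"
      using complex_rat_approx[OF e1(1)] by blast
    let ?b = "Complex (of_rat q) (of_rat r)"
    define e2 where "e2 = e / (2 * (cmod ?b + 1))"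
    have e2: "e2 > 0" "cmod ?b * e2 < e / 2"
      using half_eps[OF norm_ge_zero e, of ?b] by (simp_all add: e2_def)
    obtain t where t: "hnorm H (y \<ominus> ?g t) < e2" using approx[OF y e2(1)] by auto
    have "hnorm H (a \<odot> y \<ominus> ?b \<odot> y) = hnorm H ((a - ?b) \<odot> y)"
      using y smult_l_distr[of a "- ?b" y] smult_assoc1[of "-1" ?b y]
      by (simp add: minus_eq del: minus_complex.simps)
    also have "\<dots> \<le> e1 * hnorm H y"
      using qr y nn by (simp add: mult_right_mono)
    finally have 1: "hnorm H (a \<odot> y \<ominus> ?b \<odot> y) < e / 2" using e1 by simp
    have "hnorm H (?b \<odot> y \<ominus> ?b \<odot> ?g t) = hnorm H (?b \<odot> (y \<ominus> ?g t))"
      using y smult_assoc1[of "-1" ?b "?g t"] smult_assoc1[of ?b "-1" "?g t"]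
      by (simp add: minus_eq smult_r_distr)
    also have "\<dots> \<le> cmod ?b * e2"
      using t y by (simp add: mult_left_mono)
    finally have 2: "hnorm H (?b \<odot> y \<ominus> ?g (Gen_Scale q r t)) < e / 2" using e2 by simp
    show "\<exists>t. hnorm H (a \<odot> y \<ominus> ?g t) < e"
      using 1 2 y hnorm_diff_triangle[of "a \<odot> y" "?b \<odot> y" "?g (Gen_Scale q r t)"]
      by (intro exI[of _ "Gen_Scale q r t"]) auto
  qed
  have zero: "\<zero> \<in> ?M"
    using smult[OF \<open>x \<in> ?M\<close>, of 0] smult_l_null[OF x] by simp
  have inj: "inj_on (code d T x) ?M"
  proof (rule inj_onI, rule ccontr)
    fix y z assume y: "y \<in> ?M" and z: "z \<in> ?M" and eq: "code d T x y = code d T x z" and "y \<noteq> z"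
    then have "hnorm H (y \<ominus> z) > 0"
      using hnorm_nonneg[of "y \<ominus> z"] hnorm_eq_0[of "y \<ominus> z"] by (simp add: diff_eq_0 less_le)
    then obtain k where k: "1 / real (Suc k) < hnorm H (y \<ominus> z) / 2"
      using nat_approx_posE[of "hnorm H (y \<ominus> z) / 2"] by auto
    obtain t where t: "hnorm H (y \<ominus> ?g t) < 1 / real (Suc k)"
      using approx[OF y, of "1 / real (Suc k)"] by auto
    then have "to_nat (t, k) \<in> code d T x y" unfolding code_def by blast
    then have "hnorm H (z \<ominus> ?g t) < 1 / real (Suc k)"
      unfolding eq by (auto simp: code_def)
    then show False
      using t k y z hnorm_diff_triangle[of y "?g t" z] hnorm_minus_commute[of z "?g t"] by simp
  qed
  show "hilbert_subspace H ?M (code d T x)"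
    using closed add smult zero inj
    by (intro hilbert_subspace.intro complex_hilbert_space_axioms hilbert_subspace_axioms.intro) auto
qed

end

theorem vN_constant_universal:
  assumes "vN_constant TYPE(nat set) d n K"
  shows "vN_constant TYPE('a) d n K"
  unfolding vN_constant_def
proof (intro allI impI)
  fix H :: "'a inner_space" and T :: "nat \<Rightarrow> 'a \<Rightarrow> 'a" and p :: cpoly
  assume H: "complex_hilbert_space H" and T: "commuting_contractions H d T"
    and p: "homogeneous_poly d n p"
  interpret complex_hilbert_space H by (rule H)
  show "op_norm H (poly_op H d p T) \<le> K * polydisc_norm d p"
  proof (rule op_norm_le)
    fix x assume x: "x \<in> carrier H" "hnorm H x \<le> 1"
    note cyc = cyclic_subspace[OF T x(1)]
    interpret S: hilbert_subspace H "cyclic d T x" "code d T x" by (rule cyc(1))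
    note inv = T cyc(2)
    have T': "commuting_contractions S.H' d (S.T' T)"
      by (rule S.T'_commuting) (use inv in auto)
    have P: "poly_op H d p T x \<in> cyclic d T x \<and>
        poly_op S.H' d p (S.T' T) (code d T x x) = code d T x (poly_op H d p T x)"
      by (rule S.poly_T'[OF _ _ cyc(3)]) (use inv in auto)
    have "hnorm H (poly_op H d p T x) = hnorm S.H' (poly_op S.H' d p (S.T' T) (code d T x x))"
      using P by simp
    also have "\<dots> \<le> op_norm S.H' (poly_op S.H' d p (S.T' T))"
      using x cyc(3) by (intro S.H'.op_norm_bound[OF S.H'.poly_op_bound(2)[OF T']]) auto
    also have "\<dots> \<le> K * polydisc_norm d p"
      using assms S.hilbert_H' T' p unfolding vN_constant_def by blast
    finally show "hnorm H (poly_op H d p T x) \<le> K * polydisc_norm d p" .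
  qed
qed

lemma finite_polydisc_values:
  assumes "z \<in> polydisc d"
  shows "cmod (poly_eval d p z) \<le> (\<Sum>m\<in>Poly_Mapping.keys p. cmod (Poly_Mapping.lookup p m))"
  unfolding poly_eval_def
proof (rule sum_norm_le)
  fix m
  have "(\<Prod>i<d. cmod (z i) ^ Poly_Mapping.lookup m i) \<le> 1"
    using assms
    by (intro prod_le_1) (force simp: polydisc_def PiE_iff intro!: power_le_one intro: less_imp_le)
  then show "cmod (Poly_Mapping.lookup p m * (\<Prod>i<d. z i ^ Poly_Mapping.lookup m i))
      \<le> cmod (Poly_Mapping.lookup p m)"
    by (simp add: norm_mult norm_power flip: prod_norm) (simp add: mult_left_le)
qed

lemma poly_eval_le: "z \<in> polydisc d \<Longrightarrow> cmod (poly_eval d p z) \<le> polydisc_norm d p"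
  unfolding polydisc_norm_def
  by (intro cSUP_upper bdd_aboveI2) (auto intro: finite_polydisc_values)

lemma polydisc_norm_nonneg: "0 \<le> polydisc_norm d p"
proof -
  have "(\<lambda>i\<in>{..<d}. 0) \<in> polydisc d" by (auto simp: polydisc_def)
  from poly_eval_le[OF this] show ?thesis by (rule order_trans[OF norm_ge_zero])
qed

lemma root_of_unity_orthogonality:
  assumes "a < N" "b < N"
  shows "(\<Sum>j<N. cis (2 * pi * real a / real N) ^ j * cnj (cis (2 * pi * real b / real N) ^ j))
    = (if a = b then of_nat N else 0)"
proof -
  define w where "w = cis (2 * pi * (real a - real b) / real N)"
  have N: "N > 0" using assms by simp
  have "cis (2 * pi * real a / real N) ^ j * cnj (cis (2 * pi * real b / real N) ^ j) = w ^ j" for j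
    unfolding complex_cnj_power power_mult_distrib[symmetric]
    by (simp add: w_def cis_cnj cis_mult diff_divide_distrib right_diff_distrib)
  then have *: "(\<Sum>j<N. cis (2 * pi * real a / real N) ^ j * cnj (cis (2 * pi * real b / real N) ^ j))
      = (\<Sum>j<N. w ^ j)" by simp
  show ?thesis
  proof (cases "a = b")
    case False
    have "w \<noteq> 1"
    proof
      assume "w = 1"
      then have "cos (2 * pi * (real a - real b) / real N) = 1"
        by (simp add: w_def complex_eq_iff)
      then obtain k :: int where "2 * pi * (real a - real b) / real N = of_int k * 2 * pi"
        by (auto simp: cos_one_2pi_int)
      then have "2 * pi * ((real a - real b) / real N) = 2 * pi * of_int k"
        by simp
      then have "(real a - real b) / real N = of_int k"
        by (simp only: mult_cancel_left) simp
      then have "real_of_int (int a - int b) = real_of_int (k * int N)"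
        using N by (simp add: divide_eq_eq)
      then have "int a - int b = k * int N" by (simp only: of_int_eq_iff)
      then have "int N dvd int a - int b" by simp
      then show False
        using assms False zdvd_imp_le[of "int N" "int a - int b"] zdvd_imp_le[of "int N" "int b - int a"]
        by (cases "int a - int b > 0") (auto simp: dvd_diff_commute)
    qed
    moreover have "w ^ N = 1"
    proof -
      have "w ^ N = cis (2 * pi * of_int (int a - int b))"
        using N by (simp add: w_def Complex.DeMoivre)
      then show ?thesis by (simp only: cis_multiple_2pi Ints_of_int)
    qed
    ultimately show ?thesis using False * by (simp add: geometric_sum)
  qed (use * in \<open>simp add: w_def\<close>)
qed

lemma coeff_le_polydisc_norm:
  assumes p: "homogeneous_poly d n p" and m: "m \<in> Poly_Mapping.keys p"
  shows "cmod (Poly_Mapping.lookup p m) \<le> 2 ^ n * polydisc_norm d p"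
proof -
  let ?N = "Suc n" and ?l = Poly_Mapping.lookup
  define om where "om k = cis (2 * pi * real k / real ?N)" for k :: nat
  define G where "G = ({..<d} \<rightarrow>\<^sub>E {..<?N} :: (nat \<Rightarrow> nat) set)"
  define z where "z h = (\<lambda>i\<in>{..<d}. om (h i) / 2)" for h :: "nat \<Rightarrow> nat"
  define u where "u h = (\<Prod>i<d. cnj (om (?l m i) ^ h i))" for h
  have om: "om a ^ b = om b ^ a" for a b
    unfolding om_def Complex.DeMoivre by (simp add: mult_ac)
  have zd: "z h \<in> polydisc d" for h
    by (auto simp: z_def polydisc_def om_def norm_divide)
  have deg: "?l k i < ?N" if "k \<in> Poly_Mapping.keys p" "i < d" for k i
    using that p member_le_sum[of i "{..<d}" "?l k"]
    by (auto simp: homogeneous_poly_def less_Suc_eq_le)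
  have eq: "m = k \<longleftrightarrow> (\<forall>i<d. ?l k i = ?l m i)" if "k \<in> Poly_Mapping.keys p" for k
  proof
    assume *: "\<forall>i<d. ?l k i = ?l m i"
    have "?l k i = ?l m i" for i
    proof (cases "i < d")
      case False
      then have "i \<notin> Poly_Mapping.keys k" "i \<notin> Poly_Mapping.keys m"
        using that m p by (force simp: homogeneous_poly_def)+
      then show ?thesis by (simp add: in_keys_iff)
    qed (use * in auto)
    then show "m = k" by (intro poly_mapping_eqI) simp
  qed auto
  have val: "poly_eval d p (z h) =
      (\<Sum>k\<in>Poly_Mapping.keys p. ?l p k * (\<Prod>i<d. om (?l k i) ^ h i)) / 2 ^ n" for h
  proof -
    have "(\<Prod>i<d. z h i ^ ?l k i) = (\<Prod>i<d. om (?l k i) ^ h i) / 2 ^ n"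
      if "k \<in> Poly_Mapping.keys p" for k
    proof -
      have "(\<Prod>i<d. z h i ^ ?l k i) = (\<Prod>i<d. om (?l k i) ^ h i / 2 ^ ?l k i)"
        by (intro prod.cong) (auto simp: z_def power_divide om)
      also have "\<dots> = (\<Prod>i<d. om (?l k i) ^ h i) / 2 ^ (\<Sum>i<d. ?l k i)"
        by (simp add: prod_dividef power_sum)
      finally show ?thesis using that p by (simp add: homogeneous_poly_def)
    qed
    then show ?thesis
      by (simp add: poly_eval_def sum_divide_distrib)
  qed
  have orth: "(\<Sum>h\<in>G. (\<Prod>i<d. om (?l k i) ^ h i) * u h) = (if m = k then of_nat ?N ^ d else 0)"
    if k: "k \<in> Poly_Mapping.keys p" for k
  proof -
    have "(\<Sum>h\<in>G. (\<Prod>i<d. om (?l k i) ^ h i) * u h)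
        = (\<Sum>h\<in>G. \<Prod>i<d. om (?l k i) ^ h i * cnj (om (?l m i) ^ h i))"
      by (simp add: u_def prod.distrib)
    also have "\<dots> = (\<Prod>i<d. \<Sum>j<?N. om (?l k i) ^ j * cnj (om (?l m i) ^ j))"
      unfolding G_def by (subst prod_sum_PiE) auto
    also have "\<dots> = (\<Prod>i<d. if ?l k i = ?l m i then of_nat ?N else 0)"
      unfolding om_def using deg k m
      by (intro prod.cong refl root_of_unity_orthogonality) auto
    also have "\<dots> = (if m = k then of_nat ?N ^ d else 0)"
      by (auto simp: eq[OF k] prod_zero_iff)
    finally show ?thesis .
  qed
  have "(\<Sum>h\<in>G. poly_eval d p (z h) * u h)
      = (\<Sum>h\<in>G. \<Sum>k\<in>Poly_Mapping.keys p. ?l p k / 2 ^ n * ((\<Prod>i<d. om (?l k i) ^ h i) * u h))"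
    by (simp add: val sum_divide_distrib sum_distrib_right mult.assoc)
  also have "\<dots> = (\<Sum>k\<in>Poly_Mapping.keys p. ?l p k / 2 ^ n *
      (\<Sum>h\<in>G. (\<Prod>i<d. om (?l k i) ^ h i) * u h))"
    by (subst sum.swap) (simp add: sum_distrib_left)
  also have "\<dots> = (\<Sum>k\<in>Poly_Mapping.keys p. if m = k then ?l p k / 2 ^ n * of_nat ?N ^ d else 0)"
    by (intro sum.cong refl) (simp add: orth)
  also have "\<dots> = ?l p m / 2 ^ n * of_nat ?N ^ d"
    using m by simp
  finally have "cmod (?l p m) / 2 ^ n * real ?N ^ d = cmod (\<Sum>h\<in>G. poly_eval d p (z h) * u h)"
    by (simp add: norm_mult norm_divide norm_power del: of_nat_Suc)
  also have "\<dots> \<le> (\<Sum>h\<in>G. polydisc_norm d p)"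
  proof (rule sum_norm_le)
    fix h
    have "cmod (u h) = 1"
      by (simp add: u_def om_def norm_power flip: prod_norm)
    then show "cmod (poly_eval d p (z h) * u h) \<le> polydisc_norm d p"
      using poly_eval_le[OF zd] by (simp add: norm_mult)
  qed
  also have "\<dots> = real ?N ^ d * polydisc_norm d p"
    by (simp add: G_def card_PiE)
  finally show ?thesis
    by (simp add: field_simps del: of_nat_Suc)
qed

lemma card_keys_le:
  assumes "homogeneous_poly d n p"
  shows "card (Poly_Mapping.keys p) \<le> Suc n ^ d"
proof -
  let ?r = "\<lambda>m. restrict (Poly_Mapping.lookup m) {..<d}"
  have "inj_on ?r (Poly_Mapping.keys p)"
  proof (rule inj_onI)
    fix k m assume k: "k \<in> Poly_Mapping.keys p" and m: "m \<in> Poly_Mapping.keys p" and eq: "?r k = ?r m"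
    have "Poly_Mapping.lookup k i = Poly_Mapping.lookup m i" for i
    proof (cases "i < d")
      case True
      then show ?thesis using fun_cong[OF eq, of i] by simp
    next
      case False
      then have "i \<notin> Poly_Mapping.keys k" "i \<notin> Poly_Mapping.keys m"
        using k m assms by (force simp: homogeneous_poly_def)+
      then show ?thesis by (simp add: in_keys_iff)
    qed
    then show "k = m" by (intro poly_mapping_eqI) simp
  qed
  moreover have "?r ` Poly_Mapping.keys p \<subseteq> {..<d} \<rightarrow>\<^sub>E {..n}"
  proof (intro image_subsetI PiE_I)
    fix m i assume m: "m \<in> Poly_Mapping.keys p" and i: "i \<in> {..<d}"
    then show "?r m i \<in> {..n}"
      using assms member_le_sum[of i "{..<d}" "Poly_Mapping.lookup m"]
      by (auto simp: homogeneous_poly_def)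
  qed auto
  ultimately have "card (Poly_Mapping.keys p) \<le> card ({..<d} \<rightarrow>\<^sub>E {..n})"
    by (intro card_inj_on_le) (auto intro: finite_PiE)
  then show ?thesis by (simp add: card_PiE)
qed

lemma vN_constant_exists: "vN_constant TYPE('a) d n (real (Suc n) ^ d * 2 ^ n)"
  unfolding vN_constant_def
proof (intro allI impI)
  fix H :: "'a inner_space" and T :: "nat \<Rightarrow> 'a \<Rightarrow> 'a" and p :: cpoly
  assume H: "complex_hilbert_space H" and T: "commuting_contractions H d T"
    and p: "homogeneous_poly d n p"
  interpret complex_hilbert_space H by (rule H)
  let ?S = "\<Sum>m\<in>Poly_Mapping.keys p. cmod (Poly_Mapping.lookup p m)"
  have "op_norm H (poly_op H d p T) \<le> ?S"
  proof (rule op_norm_le)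
    fix x assume x: "x \<in> carrier H" "hnorm H x \<le> 1"
    have "hnorm H (poly_op H d p T x) \<le> ?S * hnorm H x"
      by (rule poly_op_bound(2)[OF T x(1)])
    also have "\<dots> \<le> ?S * 1" using x by (intro mult_left_mono sum_nonneg) auto
    finally show "hnorm H (poly_op H d p T x) \<le> ?S" by simp
  qed
  also have "?S \<le> real (card (Poly_Mapping.keys p)) * (2 ^ n * polydisc_norm d p)"
    using coeff_le_polydisc_norm[OF p] by (rule sum_bounded_above)
  also have "\<dots> \<le> real (Suc n) ^ d * (2 ^ n * polydisc_norm d p)"
    using card_keys_le[OF p] polydisc_norm_nonneg[of d p]
    by (intro mult_right_mono) (simp_all flip: of_nat_power del: of_nat_Suc)
  finally show "op_norm H (poly_op H d p T) \<le> real (Suc n) ^ d * 2 ^ n * polydisc_norm d p"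
    by (simp add: mult.assoc)
qed


definition scalar_space :: "complex inner_space" where
  "scalar_space = \<lparr>carrier = UNIV, mult = (*), one = 1, zero = 0, add = (+), smult = (*),
     cinner = \<lambda>x y. x * cnj y\<rparr>"

lemma scalar_space_simps [simp]:
  "carrier scalar_space = UNIV" "\<zero>\<^bsub>scalar_space\<^esub> = 0"
  "x \<oplus>\<^bsub>scalar_space\<^esub> y = x + y" "a \<odot>\<^bsub>scalar_space\<^esub> x = a * x"
  "cinner scalar_space x y = x * cnj y" "hnorm scalar_space x = cmod x"
  by (simp_all add: scalar_space_def hnorm_def cmod_def power2_eq_square)

lemma hilbert_scalar_space: "complex_hilbert_space scalar_space"
proof -
  have m: "Module.module complex_field scalar_space"
  proof (intro moduleI cring_complex_field abelian_groupI)
    fix x show "\<exists>y\<in>carrier scalar_space. y \<oplus>\<^bsub>scalar_space\<^esub> x = \<zero>\<^bsub>scalar_space\<^esub>"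
      by (auto intro: exI[of _ "- x"])
  qed (auto simp: algebra_simps)
  then interpret m: Module.module complex_field scalar_space .
  have minus: "\<ominus>\<^bsub>scalar_space\<^esub> y = - y" for y
    by (rule m.M.minus_equality) auto
  have diff: "x \<ominus>\<^bsub>scalar_space\<^esub> y = x - y" for x y
    by (simp add: a_minus_def minus)
  show ?thesis
  proof (intro complex_hilbert_space.intro m complex_hilbert_space_axioms.intro)
    fix X :: "nat \<Rightarrow> complex"
    assume "\<forall>e>0. \<exists>N. \<forall>k\<ge>N. \<forall>l\<ge>N. hnorm scalar_space (X k \<ominus>\<^bsub>scalar_space\<^esub> X l) < e"
    then have "Cauchy X" unfolding Cauchy_def by (simp add: diff dist_norm)
    then obtain x where "X \<longlonglongrightarrow> x" using Cauchy_convergent_iff convergent_def by blast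
    then have "(\<lambda>k. cmod (X k - x)) \<longlonglongrightarrow> 0"
      using LIM_zero tendsto_norm_zero by blast
    then show "\<exists>x\<in>carrier scalar_space.
        (\<lambda>k. hnorm scalar_space (X k \<ominus>\<^bsub>scalar_space\<^esub> x)) \<longlonglongrightarrow> 0"
      by (auto simp: diff)
  next
    fix x :: complex assume "x \<noteq> \<zero>\<^bsub>scalar_space\<^esub>"
    then show "0 < Re (cinner scalar_space x x)"
      by (simp add: complex_mult_cnj complex_neq_0)
  qed (auto simp: algebra_simps)
qed

lemma vN_constant_ge_1:
  assumes d: "d \<ge> 1" and K: "vN_constant TYPE(nat set) d n K"
  shows "1 \<le> K"
proof -
  interpret complex_hilbert_space scalar_space by (rule hilbert_scalar_space)
  define T :: "nat \<Rightarrow> complex \<Rightarrow> complex" where "T = (\<lambda>_. id)"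
  define m :: "nat \<Rightarrow>\<^sub>0 nat" where "m = Poly_Mapping.single 0 n"
  define p :: cpoly where "p = Poly_Mapping.single m 1"
  have keys: "Poly_Mapping.keys p = {m}" and lp: "Poly_Mapping.lookup p m = 1"
    by (simp_all add: p_def)
  have lm: "Poly_Mapping.lookup m i = (if i = 0 then n else 0)" for i
    by (auto simp: m_def lookup_single when_def)
  have T: "commuting_contractions scalar_space d T"
    by (simp add: commuting_contractions_def contraction_iff T_def linear_contraction_id)
  have p: "homogeneous_poly d n p"
    using d by (auto simp: homogeneous_poly_def keys lm in_keys_iff sum.delta split: if_splits)
  have "(T i ^^ k) 1 = 1" for i k
    by (induction k) (simp_all add: T_def)
  then have "monomial_op T m e 1 = 1" for e
    by (induction e) simp_all
  then have op: "poly_op scalar_space d p T 1 = 1"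
    unfolding poly_op_def keys by (subst M.finsum_insert) (auto simp: lp)
  have "1 = hnorm scalar_space (poly_op scalar_space d p T 1)"
    by (simp add: op)
  also have "\<dots> \<le> op_norm scalar_space (poly_op scalar_space d p T)"
    by (rule op_norm_bound[OF poly_op_bound(2)[OF T]]) auto
  also have "\<dots> \<le> K * polydisc_norm d p"
    using vN_constant_universal[OF K, where 'a = complex] T p hilbert_scalar_space
    unfolding vN_constant_def by blast
  finally have 1: "1 \<le> K * polydisc_norm d p" .
  have "polydisc_norm d p \<le> 1"
    unfolding polydisc_norm_def
  proof (rule cSUP_least)
    show "polydisc d \<noteq> {}" by (simp add: polydisc_def PiE_eq_empty_iff)
    show "cmod (poly_eval d p z) \<le> 1" if "z \<in> polydisc d" for z
      using finite_polydisc_values[OF that, of p] by (simp add: keys lp)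
  qed
  then show ?thesis
    using 1 polydisc_norm_nonneg[of d p] mult_mono[of K K "polydisc_norm d p" 1]
      mult_nonpos_nonneg[of K "polydisc_norm d p"] by (cases "K \<ge> 0") auto
qed

lemma vN_C_set_nonempty: "{K. vN_constant TYPE(nat set) d n K} \<noteq> {}"
  using vN_constant_exists[where 'a = "nat set"] by blast

theorem vN_C_ge_1: "d \<ge> 1 \<Longrightarrow> 1 \<le> vN_C d n"
  unfolding vN_C_def using vN_C_set_nonempty vN_constant_ge_1 by (intro cInf_greatest) auto

theorem vN_C_constant:
  assumes d: "d \<ge> 1"
  shows "vN_constant TYPE('a) d n (vN_C d n)"
proof (rule vN_constant_universal)
  let ?S = "{K. vN_constant TYPE(nat set) d n K}"
  show "vN_constant TYPE(nat set) d n (vN_C d n)"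
    unfolding vN_constant_def
  proof (intro allI impI)
    fix H :: "nat set inner_space" and T :: "nat \<Rightarrow> nat set \<Rightarrow> nat set" and p :: cpoly
    assume *: "complex_hilbert_space H" "commuting_contractions H d T" "homogeneous_poly d n p"
    have le: "op_norm H (poly_op H d p T) \<le> K * polydisc_norm d p" if "K \<in> ?S" for K
      using that * unfolding vN_constant_def by blast
    show "op_norm H (poly_op H d p T) \<le> vN_C d n * polydisc_norm d p"
    proof (cases "polydisc_norm d p = 0")
      case True
      then show ?thesis using le vN_C_set_nonempty[of d n] by fastforce
    next
      case False
      then have pos: "polydisc_norm d p > 0" using polydisc_norm_nonneg[of d p] by simp
      have "op_norm H (poly_op H d p T) / polydisc_norm d p \<le> vN_C d n"
        unfolding vN_C_def using le pos vN_C_set_nonempty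
        by (intro cInf_greatest) (auto simp: pos_divide_le_eq)
      then show ?thesis using pos by (simp add: pos_divide_le_eq)
    qed
  qed
qed

theorem vN_C_least:
  assumes "d \<ge> 1" "vN_constant TYPE(nat set) d n K"
  shows "vN_C d n \<le> K"
  unfolding vN_C_def using assms
  by (intro cInf_lower bdd_belowI[of _ 1]) (auto intro: vN_constant_ge_1)
end

theory Submission
  imports Defs "HOL-Library.Function_Algebras"
begin

text \<open>
  Applied to a vector \<open>x\<close>, a commuting tuple \<open>T\<close> turns the polynomial ring into a semi-inner product
  space with form \<open>\<langle>f(T)x, g(T)x\<rangle>\<close>, on which multiplication by each variable is a contraction.

  A contraction \<open>T\<close> commuting with the operators \<open>Q\<^sub>k\<close> can be replaced by unimodular scalars:
  \<open>\<Sum>\<^sub>k w\<^sub>k Q\<^sub>k T\<^sup>k x = \<Sum>\<^sub>v b\<^sub>v T\<^sup>v h\<^sub>v\<close> with \<open>h\<^sub>v = \<Sum>\<^sub>u a\<^sub>u Q\<^bsub>u+v\<^esub> T\<^sup>u x\<close> whenever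
  \<open>w\<^sub>k = \<Sum>\<^bsub>u+v=k\<^esub> a\<^sub>u b\<^sub>v\<close>, and by Parseval
  \<open>\<Sum>\<^sub>v \<parallel>h\<^sub>v\<parallel>\<^sup>2 \<le> sup\<^sub>\<omega> \<parallel>\<Sum>\<^sub>k \<omega>\<^sup>k Q\<^sub>k\<parallel>\<^sup>2 \<Sum>\<^sub>u \<bar>a\<^sub>u\<bar>\<^sup>2 \<parallel>x\<parallel>\<^sup>2\<close>.
  With \<open>a = b\<close> the coefficients of \<open>(1 - x)\<close> to the power \<open>-1/2\<close> one gets \<open>w = 1\<close> at the cost of a
  factor \<open>\<Sum>\<^bsub>u\<le>n\<^esub> a\<^sub>u\<^sup>2 = O(log n)\<close>.  With indicators of \<open>{1..n}\<close> and \<open>{0..<n}\<close> one gets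
  \<open>w\<^sub>k = k\<close> at the cost of \<open>n\<close>; since \<open>n p = \<Sum>\<^sub>s z\<^sub>s \<partial>\<^sub>s p\<close> for homogeneous \<open>p\<close>,
  one variable can be removed for the constant price \<open>d\<close>.  Removing \<open>d - 3\<close> further variables leaves a
  polynomial in two contractions, for which Ando's isometric lifting gives a dimension-free bound.
\<close>

section \<open>Semi-inner product spaces\<close>

definition root_unity :: "nat \<Rightarrow> nat \<Rightarrow> complex" where
  "root_unity N j = cis (2 * pi * real j / real N)"

lemma cmod_root_unity [simp]: "cmod (root_unity N j) = 1"
  by (simp add: root_unity_def)

lemma root_unity_power_swap: "root_unity N a ^ b = root_unity N b ^ a"
  unfolding root_unity_def Complex.DeMoivre by (simp add: mult_ac)

lemma root_unity_power_N [simp]: "root_unity N j ^ N = 1"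
proof (cases "N = 0")
  case False
  then have "root_unity N j ^ N = cis (2 * pi * of_int (int j))"
    by (simp add: root_unity_def Complex.DeMoivre)
  then show ?thesis by (simp only: cis_multiple_2pi Ints_of_int)
qed simp

lemma root_unity_power_mod: "root_unity N j ^ (k mod N) = root_unity N j ^ k"
proof -
  have "root_unity N j ^ k = root_unity N j ^ (N * (k div N) + k mod N)" by simp
  also have "\<dots> = root_unity N j ^ (k mod N)"
    by (simp only: power_add power_mult root_unity_power_N power_one mult_1)
  finally show ?thesis ..
qed

lemma root_unity_nonzero [simp]: "root_unity N j \<noteq> 0"
  using cmod_root_unity[of N j] by (metis norm_zero zero_neq_one)

text \<open>Negative frequencies are encoded by adding \<open>N\<close>, which an \<open>N\<close>th
  root of unity does not see and which keeps subtraction on \<open>nat\<close> from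
  truncating.\<close>

lemma root_unity_power_diff:
  "u \<le> N \<Longrightarrow> root_unity N j ^ (k + N - u) = root_unity N j ^ k * inverse (root_unity N j) ^ u"
  by (simp add: power_diff power_add power_inverse divide_inverse)

text \<open>The form may be degenerate. Quotients and completions are never formed; vectors are
  compared through \<open>nsq\<close> of their difference.\<close>

locale semi_inner = vector_space sc for sc :: "complex \<Rightarrow> 'v::ab_group_add \<Rightarrow> 'v" +
  fixes B :: "'v \<Rightarrow> 'v \<Rightarrow> complex"
  assumes B_add_left: "B (x + y) z = B x z + B y z"
    and B_scale_left: "B (sc c x) y = c * B x y"
    and B_commute: "B y x = cnj (B x y)"
    and B_pos: "0 \<le> Re (B x x)"
begin

definition nsq :: "'v \<Rightarrow> real" where
  "nsq x = Re (B x x)"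

lemma nsq_nonneg [simp]: "0 \<le> nsq x"
  by (simp add: nsq_def B_pos)

lemma B_self: "B x x = of_real (nsq x)"
  using B_commute[of x x] by (simp add: nsq_def complex_eq_iff)

lemma B_add_right: "B x (y + z) = B x y + B x z"
  by (metis B_add_left B_commute complex_cnj_add)

lemma B_scale_right: "B x (sc c y) = cnj c * B x y"
  by (metis B_scale_left B_commute complex_cnj_mult)

lemma B_zero_left [simp]: "B 0 x = 0"
  using B_add_left[of 0 0 x] by simp

lemma B_zero_right [simp]: "B x 0 = 0"
  using B_add_right[of x 0 0] by simp

lemma B_minus_left: "B (- x) y = - B x y"
  using B_add_left[of x "- x" y] by (simp add: add_eq_0_iff)

lemma B_minus_right: "B x (- y) = - B x y"
  using B_add_right[of x y "- y"] by (simp add: add_eq_0_iff)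

lemma B_diff_left: "B (x - y) z = B x z - B y z"
  using B_add_left[of x "- y" z] by (simp add: B_minus_left)

lemma B_diff_right: "B x (y - z) = B x y - B x z"
  using B_add_right[of x y "- z"] by (simp add: B_minus_right)

lemma B_sum_left: "B (\<Sum>i\<in>I. f i) y = (\<Sum>i\<in>I. B (f i) y)"
  by (induction I rule: infinite_finite_induct) (auto simp: B_add_left)

lemma B_sum_right: "B x (\<Sum>i\<in>I. f i) = (\<Sum>i\<in>I. B x (f i))"
  by (induction I rule: infinite_finite_induct) (auto simp: B_add_right)

lemma nsq_zero [simp]: "nsq 0 = 0"
  by (simp add: nsq_def)

lemma nsq_scale: "nsq (sc c x) = (cmod c)\<^sup>2 * nsq x"
proof -
  have "B (sc c x) (sc c x) = of_real ((cmod c)\<^sup>2 * nsq x)"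
    by (simp only: B_scale_left B_scale_right) (simp only: B_self of_real_mult complex_norm_square mult_ac)
  then show ?thesis by (simp add: nsq_def)
qed

lemma nsq_minus [simp]: "nsq (- x) = nsq x"
  by (simp add: nsq_def B_minus_left B_minus_right)

lemma nsq_add: "nsq (x + y) = nsq x + nsq y + 2 * Re (B x y)"
proof -
  have "Re (B y x) = Re (B x y)"
    using B_commute[of y x] by simp
  then show ?thesis by (simp add: nsq_def B_add_left B_add_right)
qed

text \<open>If \<open>B x y\<close> were nonzero, adding a suitable multiple of the null vector
  \<open>x\<close> to \<open>y\<close> would make \<open>nsq\<close> negative.\<close>

lemma null_imp_orthogonal:
  assumes "nsq x = 0"
  shows "B x y = 0"
proof (rule ccontr)
  assume nz: "B x y \<noteq> 0"
  \<comment> \<open>Chosen so that the cross term in \<open>nsq_add\<close> becomes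
    \<open>- 2 * nsq y - 2\<close>.\<close>
  define t where "t = - (nsq y + 1) / (cmod (B x y))\<^sup>2"
  have "B (sc (of_real t * cnj (B x y)) x) y = of_real (t * (cmod (B x y))\<^sup>2)"
    by (simp only: B_scale_left of_real_mult complex_norm_square mult_ac)
  also have "t * (cmod (B x y))\<^sup>2 = - (nsq y + 1)"
    using nz by (simp add: t_def)
  finally have "nsq (sc (of_real t * cnj (B x y)) x + y) = - nsq y - 2"
    using assms by (simp add: nsq_add nsq_scale)
  then show False
    using nsq_nonneg[of "sc (of_real t * cnj (B x y)) x + y"] nsq_nonneg[of y] by linarith
qed

lemma nsq_add_null: "nsq x = 0 \<Longrightarrow> nsq (x + y) = nsq y"
  by (simp add: nsq_add null_imp_orthogonal)

lemma nsq_diff_null: "nsq (x - y) = 0 \<Longrightarrow> nsq x = nsq y"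
  using nsq_add_null[of "x - y" y] by simp

lemma null_diff_trans: "\<lbrakk>nsq (x - y) = 0; nsq (y - z) = 0\<rbrakk> \<Longrightarrow> nsq (x - z) = 0"
  using nsq_add_null[of "x - y" "y - z"] by simp

lemma null_sum: "(\<And>i. i \<in> I \<Longrightarrow> nsq (f i) = 0) \<Longrightarrow> nsq (sum f I) = 0"
  by (induction I rule: infinite_finite_induct) (auto simp: nsq_add_null)

text \<open>Lagrange's identity: the gap between the two sides is half the double sum of the squared
  norms of \<open>b j\<close> times \<open>y i\<close> minus \<open>b i\<close> times
  \<open>y j\<close>.\<close>

lemma nsq_weighted_sum_le:
  fixes b :: "'i \<Rightarrow> real"
  assumes I: "finite I"
  shows "nsq (\<Sum>i\<in>I. sc (of_real (b i)) (y i)) \<le> (\<Sum>i\<in>I. (b i)\<^sup>2) * (\<Sum>i\<in>I. nsq (y i))"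
proof -
  let ?R = "\<lambda>i j. Re (B (y i) (y j))"
  have "0 \<le> (\<Sum>i\<in>I. \<Sum>j\<in>I. nsq (sc (of_real (b j)) (y i) - sc (of_real (b i)) (y j)))"
    by (intro sum_nonneg) simp
  also have "\<dots> = (\<Sum>i\<in>I. \<Sum>j\<in>I. (b j)\<^sup>2 * nsq (y i) + (b i)\<^sup>2 * nsq (y j) - 2 * (b i * b j * ?R i j))"
  proof (intro sum.cong refl)
    fix i j
    show "nsq (sc (of_real (b j)) (y i) - sc (of_real (b i)) (y j))
        = (b j)\<^sup>2 * nsq (y i) + (b i)\<^sup>2 * nsq (y j) - 2 * (b i * b j * ?R i j)"
      using nsq_add[of "sc (of_real (b j)) (y i)" "- sc (of_real (b i)) (y j)"]
      by (simp add: nsq_scale B_minus_right B_scale_left B_scale_right)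
  qed
  also have "\<dots> = (\<Sum>i\<in>I. \<Sum>j\<in>I. (b j)\<^sup>2 * nsq (y i)) + (\<Sum>i\<in>I. \<Sum>j\<in>I. (b i)\<^sup>2 * nsq (y j))
      - 2 * (\<Sum>i\<in>I. \<Sum>j\<in>I. b i * b j * ?R i j)"
    by (simp add: sum.distrib sum_subtractf sum_distrib_left)
  also have "(\<Sum>i\<in>I. \<Sum>j\<in>I. (b j)\<^sup>2 * nsq (y i)) = (\<Sum>i\<in>I. (b i)\<^sup>2) * (\<Sum>i\<in>I. nsq (y i))"
    by (subst sum.swap) (simp add: sum_product)
  also have "(\<Sum>i\<in>I. \<Sum>j\<in>I. (b i)\<^sup>2 * nsq (y j)) = (\<Sum>i\<in>I. (b i)\<^sup>2) * (\<Sum>i\<in>I. nsq (y i))"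
    by (simp add: sum_product)
  also have "(\<Sum>i\<in>I. \<Sum>j\<in>I. b i * b j * ?R i j) = nsq (\<Sum>i\<in>I. sc (of_real (b i)) (y i))"
    unfolding nsq_def
    by (simp only: B_sum_left) (simp add: B_sum_right B_scale_left B_scale_right sum_distrib_left mult_ac)
  finally show ?thesis by linarith
qed

lemma Parseval_basic:
  assumes "N > 0"
  shows "(\<Sum>j<N. nsq (\<Sum>r<N. sc (root_unity N j ^ r) (y r))) = real N * (\<Sum>r<N. nsq (y r))"
proof -
  \<comment> \<open>The known relation sums over exponents, here the sum runs over the roots;
    \<open>root_unity_power_swap\<close> exchanges the two.\<close>
  have orth: "(\<Sum>j<N. root_unity N j ^ a * cnj (root_unity N j ^ b)) = (if a = b then of_nat N else 0)"
    if "a < N" "b < N" for a b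
    using root_of_unity_orthogonality[OF that]
    unfolding root_unity_power_swap[of N _ a] root_unity_power_swap[of N _ b]
    by (simp only: root_unity_def)
  have "(\<Sum>j<N. B (\<Sum>r<N. sc (root_unity N j ^ r) (y r)) (\<Sum>r<N. sc (root_unity N j ^ r) (y r)))
      = (\<Sum>j<N. \<Sum>a<N. \<Sum>b<N. root_unity N j ^ a * cnj (root_unity N j ^ b) * B (y a) (y b))"
    by (simp only: B_sum_left) (simp add: B_sum_right B_scale_left B_scale_right sum_distrib_left mult_ac)
  also have "\<dots> = (\<Sum>a<N. \<Sum>j<N. \<Sum>b<N. root_unity N j ^ a * cnj (root_unity N j ^ b) * B (y a) (y b))"
    by (rule sum.swap)
  also have "\<dots> = (\<Sum>a<N. \<Sum>b<N. \<Sum>j<N. root_unity N j ^ a * cnj (root_unity N j ^ b) * B (y a) (y b))"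
    by (intro sum.cong refl sum.swap)
  also have "\<dots> = (\<Sum>a<N. \<Sum>b<N. (if a = b then of_nat N else 0) * B (y a) (y b))"
    by (intro sum.cong refl) (simp add: orth del: complex_cnj_power flip: sum_distrib_right)
  also have "\<dots> = of_real (real N * (\<Sum>r<N. nsq (y r)))"
    by (simp add: if_distrib[of "\<lambda>c. c * _"] B_self sum_distrib_left cong: if_cong)
  finally show ?thesis
    unfolding nsq_def by (metis Re_complex_of_real Re_sum)
qed

text \<open>Indices whose frequencies agree modulo \<open>N\<close> carry the same character and are
  merged first, so products of Fourier sums can be fed in directly.\<close>

lemma Parseval:
  assumes "N > 0" "finite I"
  shows "(\<Sum>j<N. nsq (\<Sum>i\<in>I. sc (root_unity N j ^ \<kappa> i) (y i)))
    = real N * (\<Sum>r<N. nsq (\<Sum>i\<in>{i \<in> I. \<kappa> i mod N = r}. y i))"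
proof -
  have "(\<Sum>i\<in>I. sc (root_unity N j ^ \<kappa> i) (y i))
      = (\<Sum>r<N. sc (root_unity N j ^ r) (\<Sum>i\<in>{i \<in> I. \<kappa> i mod N = r}. y i))" for j
  proof -
    have "(\<Sum>i\<in>I. sc (root_unity N j ^ \<kappa> i) (y i))
        = (\<Sum>r<N. \<Sum>i\<in>{i \<in> I. \<kappa> i mod N = r}. sc (root_unity N j ^ \<kappa> i) (y i))"
      using assms by (intro sum.group[symmetric]) auto
    also have "\<dots> = (\<Sum>r<N. \<Sum>i\<in>{i \<in> I. \<kappa> i mod N = r}. sc (root_unity N j ^ r) (y i))"
      by (intro sum.cong refl) (auto simp: root_unity_power_mod)
    finally show ?thesis by (simp add: scale_sum_right)
  qed
  then show ?thesis using Parseval_basic[OF assms(1)] by simp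
qed

lemma Parseval_2D:
  assumes N: "N > 0" and I: "finite I"
  shows "(\<Sum>j<N. \<Sum>j'<N. nsq (\<Sum>i\<in>I. sc (root_unity N j ^ \<kappa> i * root_unity N j' ^ \<mu> i) (y i)))
    = (real N)\<^sup>2 * (\<Sum>r<N. \<Sum>r'<N. nsq (\<Sum>i\<in>{i \<in> I. \<kappa> i mod N = r \<and> \<mu> i mod N = r'}. y i))"
proof -
  have "(\<Sum>j<N. \<Sum>j'<N. nsq (\<Sum>i\<in>I. sc (root_unity N j ^ \<kappa> i * root_unity N j' ^ \<mu> i) (y i)))
      = (\<Sum>j'<N. \<Sum>j<N. nsq (\<Sum>i\<in>I. sc (root_unity N j ^ \<kappa> i) (sc (root_unity N j' ^ \<mu> i) (y i))))"
    by (subst sum.swap) simp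
  also have "\<dots> = (\<Sum>j'<N. real N * (\<Sum>r<N. nsq (\<Sum>i\<in>{i \<in> I. \<kappa> i mod N = r}. sc (root_unity N j' ^ \<mu> i) (y i))))"
    by (intro sum.cong refl Parseval assms)
  also have "\<dots> = real N * (\<Sum>r<N. \<Sum>j'<N. nsq (\<Sum>i\<in>{i \<in> I. \<kappa> i mod N = r}. sc (root_unity N j' ^ \<mu> i) (y i)))"
    by (subst sum.swap) (simp add: sum_distrib_left)
  also have "\<dots> = real N * (\<Sum>r<N. real N * (\<Sum>r'<N.
      nsq (\<Sum>i\<in>{i \<in> {i \<in> I. \<kappa> i mod N = r}. \<mu> i mod N = r'}. y i)))"
    using assms by (subst Parseval) auto
  finally show ?thesis
    by (simp add: power2_eq_square sum_distrib_left mult.assoc)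
qed

section \<open>Isometries matching finitely many vectors\<close>

lemma B_polarization:
  "4 * B x y = of_real (nsq (x + y)) - of_real (nsq (x + sc (- 1) y))
    + \<i> * (of_real (nsq (x + sc \<i> y)) - of_real (nsq (x + sc (- \<i>) y)))"
  by (simp add: B_self[symmetric] B_add_left B_add_right B_diff_left B_diff_right B_minus_left
      B_minus_right B_scale_left B_scale_right algebra_simps)

lemma isometry_preserves_B:
  assumes "Vector_Spaces.linear sc sc G" "\<And>x. nsq (G x) = nsq x"
  shows "B (G x) (G y) = B x y"
proof -
  interpret G: Vector_Spaces.linear sc sc G by (rule assms(1))
  have "4 * B (G x) (G y) = 4 * B x y"
    unfolding B_polarization by (simp only: assms(2) flip: G.add G.scale)
  then show ?thesis by simp
qed

text \<open>The isometry is a product of complex Householder reflections \<open>x \<mapsto> x - \<langle>x, c\<rangle> / \<langle>a, c\<rangle> c\<close>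
  with \<open>c = a - b\<close>: such a map sends \<open>a\<close> to \<open>b\<close> and fixes everything orthogonal to \<open>c\<close>.\<close>

lemma exists_isometry:
  assumes "finite S" "\<And>i j. \<lbrakk>i \<in> S; j \<in> S\<rbrakk> \<Longrightarrow> B (a i) (a j) = B (b i) (b j)"
  shows "\<exists>G G'. Vector_Spaces.linear sc sc G \<and> Vector_Spaces.linear sc sc G' \<and>
    (\<forall>x. G (G' x) = x) \<and> (\<forall>x. G' (G x) = x) \<and> (\<forall>x. nsq (G x) = nsq x) \<and>
    (\<forall>i\<in>S. nsq (G (a i) - b i) = 0)"
  using assms
proof (induction S rule: finite_induct)
  case empty
  show ?case
    by (intro exI[of _ "\<lambda>x. x"]) (simp add: linear_ident)
next
  case (insert k S)
  then obtain G G' where lin: "Vector_Spaces.linear sc sc G" "Vector_Spaces.linear sc sc G'"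
    and inv: "\<And>x. G (G' x) = x" "\<And>x. G' (G x) = x"
    and iso: "\<And>x. nsq (G x) = nsq x" and G: "\<And>i. i \<in> S \<Longrightarrow> nsq (G (a i) - b i) = 0"
    by (metis insertCI)
  have isoB: "B (G x) (G y) = B x y" for x y
    by (rule isometry_preserves_B[OF lin(1) iso])
  define c where "c = G (a k) - b k"
  show ?case
  proof (cases "nsq c = 0")
    case True
    then show ?thesis
      using lin inv iso G by - (rule exI[of _ G], rule exI[of _ G'], auto simp: c_def)
  next
    case False
    \<comment> \<open>Equal norms of \<open>G (a k)\<close> and \<open>b k\<close> make
      \<open>B c c\<close> twice the real part of \<open>s\<close>. Hence \<open>s\<close> is
      nonzero, and \<open>1 / s\<close> is the coefficient for which the reflection is
      unitary.\<close>
    define s where "s = B (G (a k)) c"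
    define \<tau> where "\<tau> = 1 / s"
    have kk: "B (b k) (b k) = B (G (a k)) (G (a k))"
      using insert.prems[of k k] by (simp add: isoB)
    have "cnj s = B c (G (a k))"
      unfolding s_def by (rule B_commute[symmetric])
    then have nc: "B c c = s + cnj s"
      using kk by (simp add: s_def c_def B_diff_left B_diff_right)
    have "s \<noteq> 0"
    proof
      assume "s = 0"
      then show False using nc False by (simp add: B_self)
    qed
    have unit: "cnj \<tau> * (\<tau> * B c c) = \<tau> + cnj \<tau>"
      unfolding nc \<tau>_def using \<open>s \<noteq> 0\<close> by (simp add: field_simps)
    \<comment> \<open>\<open>c\<close> is orthogonal to everything matched so far, so the reflection
      does not disturb the earlier indices.\<close>
    have orth: "B (b i) c = 0" if "i \<in> S" for i
    proof -
      have "B (b i) (G (a k)) = B (G (a i)) (G (a k))"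
        using null_imp_orthogonal[OF G[OF that], of "G (a k)"] by (simp add: B_diff_left)
      then show ?thesis
        using insert.prems[of i k] that by (simp add: c_def B_diff_right isoB)
    qed
    have orth': "B (G (a i)) c = 0" if "i \<in> S" for i
      using null_imp_orthogonal[OF G[OF that], of c] orth[OF that] by (simp add: B_diff_left)
    define U where "U x = x - sc (\<tau> * B x c) c" for x
    \<comment> \<open>The inverse reflection has the conjugate coefficient; \<open>unit\<close>
      makes the two cancel.\<close>
    define U' where "U' x = x - sc (cnj \<tau> * B x c) c" for x
    have linU: "Vector_Spaces.linear sc sc U" "Vector_Spaces.linear sc sc U'"
      unfolding U_def U'_def
      by (unfold_locales; simp add: B_add_left B_scale_left scale_right_distrib scale_left_distrib
        scale_right_diff_distrib algebra_simps)+
    have UU: "U (U' x) = x" "U' (U x) = x" for x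
    proof -
      have "\<tau> * (B x c - cnj \<tau> * B x c * B c c) + cnj \<tau> * B x c = 0"
        using arg_cong[OF unit, of "\<lambda>t. t * B x c"] by (simp add: algebra_simps)
      moreover have "cnj \<tau> * (B x c - \<tau> * B x c * B c c) + \<tau> * B x c = 0"
        using arg_cong[OF unit, of "\<lambda>t. t * B x c"] by (simp add: algebra_simps)
      ultimately show "U (U' x) = x" "U' (U x) = x"
        by (simp_all add: U_def U'_def B_diff_left B_scale_left diff_diff_eq flip: scale_left_distrib)
          (simp_all add: algebra_simps)
    qed
    have isoU: "nsq (U x) = nsq x" for x
    proof -
      have "B (U x) (U x) = B x x + B x c * cnj (B x c) * (cnj \<tau> * (\<tau> * B c c) - (\<tau> + cnj \<tau>))"
        using B_commute[of x c]
        by (simp add: U_def B_diff_left B_diff_right B_scale_left B_scale_right algebra_simps)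
      then show ?thesis by (simp add: nsq_def unit)
    qed
    have "nsq (U (G (a i)) - b i) = 0" if "i \<in> insert k S" for i
    proof (cases "i = k")
      case True
      have "U (G (a k)) = G (a k) - c"
        using \<open>s \<noteq> 0\<close> by (simp add: U_def \<tau>_def flip: s_def)
      then show ?thesis by (simp add: True c_def)
    next
      case False
      then show ?thesis using that G orth' by (simp add: U_def)
    qed
    moreover have "Vector_Spaces.linear sc sc (U \<circ> G)" "Vector_Spaces.linear sc sc (G' \<circ> U')"
      using linU lin by (blast intro: Vector_Spaces.linear_compose)+
    ultimately show ?thesis
      by - (rule exI[of _ "U \<circ> G"], rule exI[of _ "G' \<circ> U'"], simp add: UU inv iso isoU comp_def)
  qed
qed

text \<open>A cyclic correlation modulo \<open>N\<close> in both indices turns, under the discrete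
  Fourier transform, into multiplication by values of the polynomial with coefficients
  \<open>a\<close> at unimodular points, so its norm is at most \<open>M\<close>. On the
  \<open>R\<close> by \<open>R\<close> corner no index wraps around, and the cyclic sum is the plain
  one.\<close>

lemma array_average:
  fixes S :: "'s set"
  assumes S: "finite S" and k: "\<And>s. s \<in> S \<Longrightarrow> k s \<le> n" and l: "\<And>s. s \<in> S \<Longrightarrow> l s \<le> n"
    and M: "\<And>\<omega> \<omega>'. \<lbrakk>cmod \<omega> = 1; cmod \<omega>' = 1\<rbrakk> \<Longrightarrow> cmod (\<Sum>s\<in>S. a s * \<omega> ^ k s * \<omega>' ^ l s) \<le> M"
    and N: "N = R + n" "R > 0"
  shows "(\<Sum>g<R. \<Sum>g'<R. nsq (\<Sum>s\<in>S. sc (a s) (F (g + k s) (g' + l s))))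
    \<le> M\<^sup>2 * (\<Sum>g<N. \<Sum>g'<N. nsq (F g g'))"
proof -
  let ?\<omega> = "root_unity N"
  define I where "I = S \<times> ({..<N} \<times> {..<N})"
  define \<kappa> where "\<kappa> i = fst (snd i) + N - k (fst i)" for i :: "'s \<times> nat \<times> nat"
  define \<mu> where "\<mu> i = snd (snd i) + N - l (fst i)" for i :: "'s \<times> nat \<times> nat"
  define y where "y i = sc (a (fst i)) (F (fst (snd i)) (snd (snd i)))" for i
  have Npos: "N > 0" using N by simp
  have I: "finite I" using S by (simp add: I_def)
  have M0: "M \<ge> 0" using M[of 1 1] by (meson norm_ge_zero norm_one order_trans)
  \<comment> \<open>If \<open>p < t\<close>, the residue is \<open>p + N - t\<close>, which is at
    least \<open>N - n = R\<close> and so misses the corner.\<close>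
  have modN: "(p + N - t) mod N = r \<longleftrightarrow> p = r + t" if "p < N" "t \<le> n" "r < R" for p t r
  proof (cases "t \<le> p")
    case True
    then have "p + N - t = (p - t) + N" by simp
    then have "(p + N - t) mod N = p - t"
      using that by (simp only: mod_add_self2) simp
    then show ?thesis using True by auto
  next
    case False
    then have "p + N - t < N" "p + N - t \<ge> R" using that N by auto
    then show ?thesis using that False by simp
  qed
  have grp: "(\<Sum>i\<in>{i \<in> I. \<kappa> i mod N = r \<and> \<mu> i mod N = r'}. y i)
      = (\<Sum>s\<in>S. sc (a s) (F (r + k s) (r' + l s)))" if "r < R" "r' < R" for r r'
  proof -
    have "{i \<in> I. \<kappa> i mod N = r \<and> \<mu> i mod N = r'} = (\<lambda>s. (s, r + k s, r' + l s)) ` S"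
    proof (intro Set.set_eqI iffI)
      fix i assume "i \<in> {i \<in> I. \<kappa> i mod N = r \<and> \<mu> i mod N = r'}"
      then obtain s p q where i: "i = (s, p, q)" "s \<in> S" "p < N" "q < N"
        and "(p + N - k s) mod N = r" "(q + N - l s) mod N = r'"
        by (cases i) (auto simp: I_def \<kappa>_def \<mu>_def)
      then have "p = r + k s" "q = r' + l s"
        using modN[of p "k s" r] modN[of q "l s" r'] k l that by auto
      then show "i \<in> (\<lambda>s. (s, r + k s, r' + l s)) ` S"
        using i by simp
    next
      fix i assume "i \<in> (\<lambda>s. (s, r + k s, r' + l s)) ` S"
      then obtain s where s: "s \<in> S" "i = (s, r + k s, r' + l s)" by auto
      then have "r + k s < N" "r' + l s < N" using that k l N by (auto intro: add_less_le_mono)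
      then show "i \<in> {i \<in> I. \<kappa> i mod N = r \<and> \<mu> i mod N = r'}"
        using s that k l by (simp add: I_def \<kappa>_def \<mu>_def modN)
    qed
    then show ?thesis
      by (simp add: sum.reindex inj_on_def y_def)
  qed
  have "(real N)\<^sup>2 * (\<Sum>g<R. \<Sum>g'<R. nsq (\<Sum>s\<in>S. sc (a s) (F (g + k s) (g' + l s))))
      = (real N)\<^sup>2 * (\<Sum>g<R. \<Sum>g'<R. nsq (\<Sum>i\<in>{i \<in> I. \<kappa> i mod N = g \<and> \<mu> i mod N = g'}. y i))"
    by (simp add: grp)
  also have "\<dots> \<le> (real N)\<^sup>2 * (\<Sum>g<N. \<Sum>g'<N. nsq (\<Sum>i\<in>{i \<in> I. \<kappa> i mod N = g \<and> \<mu> i mod N = g'}. y i))"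
  proof (intro mult_left_mono)
    have "(\<Sum>g<R. \<Sum>g'<R. nsq (\<Sum>i\<in>{i \<in> I. \<kappa> i mod N = g \<and> \<mu> i mod N = g'}. y i))
      \<le> (\<Sum>g<R. \<Sum>g'<N. nsq (\<Sum>i\<in>{i \<in> I. \<kappa> i mod N = g \<and> \<mu> i mod N = g'}. y i))"
      using N by (intro sum_mono sum_mono2) auto
    also have "\<dots> \<le> (\<Sum>g<N. \<Sum>g'<N. nsq (\<Sum>i\<in>{i \<in> I. \<kappa> i mod N = g \<and> \<mu> i mod N = g'}. y i))"
      using N by (intro sum_mono2 sum_nonneg) auto
    finally show "(\<Sum>g<R. \<Sum>g'<R. nsq (\<Sum>i\<in>{i \<in> I. \<kappa> i mod N = g \<and> \<mu> i mod N = g'}. y i))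
      \<le> (\<Sum>g<N. \<Sum>g'<N. nsq (\<Sum>i\<in>{i \<in> I. \<kappa> i mod N = g \<and> \<mu> i mod N = g'}. y i))" .
  qed simp
  also have "\<dots> = (\<Sum>j<N. \<Sum>j'<N. nsq (\<Sum>i\<in>I. sc (?\<omega> j ^ \<kappa> i * ?\<omega> j' ^ \<mu> i) (y i)))"
    by (rule Parseval_2D[OF Npos I, symmetric])
  also have "\<dots> \<le> (\<Sum>j<N. \<Sum>j'<N. M\<^sup>2 *
      nsq (\<Sum>i\<in>{..<N} \<times> {..<N}. sc (?\<omega> j ^ fst i * ?\<omega> j' ^ snd i) (F (fst i) (snd i))))"
  proof (intro sum_mono)
    fix j j'
    \<comment> \<open>The polynomial at the inverses of two roots of unity, which are unimodular, so
      \<open>M\<close> bounds it.\<close>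
    let ?c = "\<Sum>s\<in>S. a s * inverse (?\<omega> j) ^ k s * inverse (?\<omega> j') ^ l s"
    let ?v = "\<Sum>i\<in>{..<N} \<times> {..<N}. sc (?\<omega> j ^ fst i * ?\<omega> j' ^ snd i) (F (fst i) (snd i))"
    have "(\<Sum>i\<in>I. sc (?\<omega> j ^ \<kappa> i * ?\<omega> j' ^ \<mu> i) (y i))
        = (\<Sum>s\<in>S. \<Sum>i\<in>{..<N} \<times> {..<N}. sc (a s * inverse (?\<omega> j) ^ k s * inverse (?\<omega> j') ^ l s)
            (sc (?\<omega> j ^ fst i * ?\<omega> j' ^ snd i) (F (fst i) (snd i))))"
      unfolding I_def sum.cartesian_product
    proof (intro sum.cong refl)
      fix i assume "i \<in> S \<times> {..<N} \<times> {..<N}"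
      then have "fst i \<in> S" by auto
      then have "k (fst i) \<le> N" "l (fst i) \<le> N" using k[of "fst i"] l[of "fst i"] N by simp_all
      then show "sc (?\<omega> j ^ \<kappa> i * ?\<omega> j' ^ \<mu> i) (y i)
          = (case i of (s, i) \<Rightarrow> sc (a s * inverse (?\<omega> j) ^ k s * inverse (?\<omega> j') ^ l s)
            (sc (?\<omega> j ^ fst i * ?\<omega> j' ^ snd i) (F (fst i) (snd i))))"
        by (simp add: \<kappa>_def \<mu>_def y_def root_unity_power_diff case_prod_beta mult_ac)
    qed
    also have "\<dots> = sc ?c ?v"
      unfolding scale_sum_left by (simp only: scale_sum_right)
    finally have "nsq (\<Sum>i\<in>I. sc (?\<omega> j ^ \<kappa> i * ?\<omega> j' ^ \<mu> i) (y i)) = (cmod ?c)\<^sup>2 * nsq ?v"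
      by (simp add: nsq_scale)
    also have "\<dots> \<le> M\<^sup>2 * nsq ?v"
      by (intro mult_right_mono power_mono M) (simp_all add: norm_inverse)
    finally show "nsq (\<Sum>i\<in>I. sc (?\<omega> j ^ \<kappa> i * ?\<omega> j' ^ \<mu> i) (y i)) \<le> M\<^sup>2 * nsq ?v" .
  qed
  also have "\<dots> = M\<^sup>2 * ((real N)\<^sup>2 * (\<Sum>g<N. \<Sum>g'<N.
      nsq (\<Sum>i\<in>{i \<in> {..<N} \<times> {..<N}. fst i mod N = g \<and> snd i mod N = g'}. F (fst i) (snd i))))"
    by (subst Parseval_2D[OF Npos, symmetric]) (simp_all only: sum_distrib_left finite_SigmaI finite_lessThan)
  also have "(\<Sum>g<N. \<Sum>g'<N.
      nsq (\<Sum>i\<in>{i \<in> {..<N} \<times> {..<N}. fst i mod N = g \<and> snd i mod N = g'}. F (fst i) (snd i)))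
      = (\<Sum>g<N. \<Sum>g'<N. nsq (F g g'))"
  proof (intro sum.cong refl)
    fix g g' assume "g \<in> {..<N}" "g' \<in> {..<N}"
    then have "{i \<in> {..<N} \<times> {..<N}. fst i mod N = g \<and> snd i mod N = g'} = {(g, g')}" by auto
    then show "nsq (\<Sum>i\<in>{i \<in> {..<N} \<times> {..<N}. fst i mod N = g \<and> snd i mod N = g'}. F (fst i) (snd i))
      = nsq (F g g')" by simp
  qed
  finally show ?thesis using Npos by (simp add: mult.left_commute)
qed

end

lemma semi_inner_prod:
  assumes "semi_inner s B" "semi_inner t C"
  shows "semi_inner (\<lambda>c p. (s c (fst p), t c (snd p))) (\<lambda>p q. B (fst p) (fst q) + C (snd p) (snd q))"
proof -
  interpret B: semi_inner s B by (rule assms)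
  interpret C: semi_inner t C by (rule assms)
  show ?thesis
  proof (unfold_locales, goal_cases)
    case (7 x y)
    then show ?case using B.B_commute[of "fst y" "fst x"] C.B_commute[of "snd y" "snd x"] by simp
  qed (auto simp: B.scale_right_distrib C.scale_right_distrib B.scale_left_distrib C.scale_left_distrib
      B.B_add_left C.B_add_left B.B_scale_left C.B_scale_left B.B_pos C.B_pos algebra_simps)
qed

lemma semi_inner_fun:
  assumes "semi_inner s B"
  shows "semi_inner (\<lambda>c e j. s c (e j)) (\<lambda>e e'. \<Sum>j<(L::nat). B (e j) (e' j))"
proof -
  interpret semi_inner s B by (rule assms)
  show ?thesis
  proof (unfold_locales, goal_cases)
    case (7 x y)
    then show ?case unfolding cnj_sum by (intro sum.cong refl B_commute)
  qed (auto simp: fun_eq_iff scale_right_distrib scale_left_distrib B_add_left B_scale_left B_pos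
      sum.distrib sum_distrib_left intro: sum_nonneg)
qed

section \<open>Replacing a contraction by unimodular scalars\<close>

text \<open>Vectors, operators and scalars live in one commutative ring, with \<open>cst\<close>
  embedding the scalars. Thus replacing a contraction by a number is a substitution in the same
  expression.\<close>

locale algebra_form = vector_space "\<lambda>c f. cst c * f" + semi_inner "\<lambda>c f. cst c * f" B
  for cst :: "complex \<Rightarrow> 'r::comm_ring_1" and B
begin

text \<open>\<open>K\<close> stands for the square of an operator norm, so all prices below appear
  squared.\<close>

definition bnd :: "real \<Rightarrow> 'r \<Rightarrow> bool" where
  "bnd K q \<longleftrightarrow> (\<forall>f. nsq (q * f) \<le> K * nsq f)"

abbreviation contractive :: "'r \<Rightarrow> bool" where
  "contractive \<equiv> bnd 1"

lemma cst_one [simp]: "cst 1 = 1"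
  using scale_one[of 1] by simp

lemma cst_mult: "cst (a * b) = cst a * cst b"
  using scale_scale[of a b 1] by simp

lemma contractive_power: "contractive X \<Longrightarrow> nsq (X ^ k * f) \<le> nsq f"
proof (induction k)
  case (Suc k)
  have "nsq (X ^ Suc k * f) = nsq (X * (X ^ k * f))" by (simp add: mult.assoc)
  also have "\<dots> \<le> nsq (X ^ k * f)" using Suc.prems by (simp add: bnd_def)
  finally show ?case using Suc by simp
qed simp

text \<open>Since \<open>w\<close> is the Cauchy product of \<open>b\<close> and \<open>a\<close>,
  each power of \<open>X\<close> splits into two factors: the one weighted by \<open>a\<close> is
  absorbed into the vectors \<open>h v\<close> through Parseval, the one weighted by
  \<open>b\<close> is removed by Cauchy-Schwarz.\<close>

lemma bnd_weighted:
  assumes X: "contractive X" and S: "finite S" and k: "\<And>m. m \<in> S \<Longrightarrow> k m \<le> n"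
    and bnd: "\<And>\<omega>. cmod \<omega> = 1 \<Longrightarrow> bnd K (\<Sum>m\<in>S. cst (\<omega> ^ k m) * c m)"
    and w: "\<And>j. j \<le> n \<Longrightarrow> w j = (\<Sum>u\<le>j. b (j - u) * a u)"
  shows "bnd ((\<Sum>v\<le>n. (b v)\<^sup>2) * (\<Sum>u\<le>n. (a u)\<^sup>2) * K) (\<Sum>m\<in>S. cst (of_real (w (k m))) * c m * X ^ k m)"
    (is "bnd (?b2 * ?a2 * K) ?q")
  unfolding bnd_def
proof
  fix F
  \<comment> \<open>\<open>N\<close> is large enough that \<open>k - u\<close> does not wrap around modulo \<open>N\<close> for \<open>k, u \<le> n\<close>.\<close>
  define N where "N = 2 * n + 1"
  have N: "N > 0" by (simp add: N_def)
  let ?\<omega> = "root_unity N"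
  define y where "y u = cst (of_real (a u)) * (X ^ u * F)" for u
  define I where "I = S \<times> {..n}"
  define \<kappa> where "\<kappa> i = k (fst i) + N - snd i" for i
  define z where "z i = c (fst i) * y (snd i)" for i
  \<comment> \<open>The Fourier coefficient at \<open>v\<close> of the product of the polynomial in
    \<omega> with coefficients \<open>c m\<close> and the sum of the \<open>y u\<close> at
    frequencies \<open>- u\<close>.\<close>
  define h where "h v = (\<Sum>i\<in>{i \<in> I. \<kappa> i mod N = v}. z i)" for v
  have I: "finite I" using S by (simp add: I_def)
  \<comment> \<open>Pairs with \<open>u > k m\<close> have residue at least
    \<open>N - n = n + 1\<close>, so they do not enter \<open>h v\<close> for
    \<open>v \<le> n\<close>.\<close>
  have kap: "\<kappa> (m, u) mod N = v \<longleftrightarrow> k m = u + v" if "m \<in> S" "u \<le> n" "v \<le> n" for m u v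
  proof (cases "u \<le> k m")
    case True
    then have "\<kappa> (m, u) = (k m - u) + N" by (simp add: \<kappa>_def)
    moreover have "k m - u < N" using k[OF that(1)] by (simp add: N_def)
    ultimately have "\<kappa> (m, u) mod N = k m - u" by (simp only: mod_add_self2 mod_less)
    then show ?thesis using True by auto
  next
    case False
    then have "\<kappa> (m, u) = k m + N - u" "k m + N - u < N" "k m + N - u > n"
      using that by (auto simp: \<kappa>_def N_def)
    then show ?thesis using that False by simp
  qed
  have h_eq: "h v = (\<Sum>m\<in>S. if v \<le> k m then c m * y (k m - v) else 0)" if "v \<le> n" for v
  proof -
    have "h v = (\<Sum>i\<in>I. if \<kappa> i mod N = v then z i else 0)"
      unfolding h_def using I by (rule sum.inter_filter)
    also have "\<dots> = (\<Sum>m\<in>S. \<Sum>u\<le>n. if \<kappa> (m, u) mod N = v then z (m, u) else 0)"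
      unfolding I_def by (subst sum.cartesian_product) (auto intro!: sum.cong)
    also have "\<dots> = (\<Sum>m\<in>S. \<Sum>u\<le>n. if u = k m - v \<and> v \<le> k m then c m * y u else 0)"
      using that by (intro sum.cong refl) (auto simp: kap z_def)
    also have "\<dots> = (\<Sum>m\<in>S. if v \<le> k m then c m * y (k m - v) else 0)"
    proof (intro sum.cong refl)
      fix m assume "m \<in> S"
      then have "k m - v \<in> {..n}" using k[of m] by simp
      then show "(\<Sum>u\<le>n. if u = k m - v \<and> v \<le> k m then c m * y u else 0)
          = (if v \<le> k m then c m * y (k m - v) else 0)"
        by (cases "v \<le> k m") simp_all
    qed
    finally show ?thesis .
  qed
  have qF: "?q * F = (\<Sum>v\<le>n. cst (of_real (b v)) * (X ^ v * h v))"
  proof -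
    have "(\<Sum>v\<le>n. cst (of_real (b v)) * (X ^ v * h v))
        = (\<Sum>v\<le>n. \<Sum>m\<in>S. cst (of_real (b v)) * (X ^ v * (if v \<le> k m then c m * y (k m - v) else 0)))"
      by (simp add: h_eq sum_distrib_left)
    also have "\<dots> = (\<Sum>m\<in>S. \<Sum>v\<le>n. cst (of_real (b v)) * (X ^ v * (if v \<le> k m then c m * y (k m - v) else 0)))"
      by (rule sum.swap)
    also have "\<dots> = (\<Sum>m\<in>S. cst (of_real (w (k m))) * c m * X ^ k m * F)"
    proof (intro sum.cong refl)
      fix m assume m: "m \<in> S"
      have "(\<Sum>v\<le>n. cst (of_real (b v)) * (X ^ v * (if v \<le> k m then c m * y (k m - v) else 0)))
          = (\<Sum>v\<le>k m. cst (of_real (b v)) * (X ^ v * (c m * y (k m - v))))"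
        using k[OF m] by (intro sum.mono_neutral_cong_right) auto
      also have "\<dots> = (\<Sum>v\<le>k m. cst (of_real (b v * a (k m - v))) * (c m * X ^ k m * F))"
      proof (intro sum.cong refl)
        fix v assume "v \<in> {..k m}"
        then have "X ^ k m = X ^ v * X ^ (k m - v)"
          by (simp flip: power_add)
        then show "cst (of_real (b v)) * (X ^ v * (c m * y (k m - v)))
            = cst (of_real (b v * a (k m - v))) * (c m * X ^ k m * F)"
          by (simp add: y_def cst_mult mult_ac)
      qed
      also have "\<dots> = cst (of_real (\<Sum>v\<le>k m. b v * a (k m - v))) * (c m * X ^ k m * F)"
        by (simp add: scale_sum_left)
      also have "(\<Sum>v\<le>k m. b v * a (k m - v)) = w (k m)"
        unfolding w[OF k[OF m]]
        by (rule sum.reindex_bij_witness[of _ "\<lambda>u. k m - u" "\<lambda>u. k m - u"]) auto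
      finally show "(\<Sum>v\<le>n. cst (of_real (b v)) * (X ^ v * (if v \<le> k m then c m * y (k m - v) else 0)))
          = cst (of_real (w (k m))) * c m * X ^ k m * F" by (simp add: mult.assoc)
    qed
    finally show ?thesis by (simp add: sum_distrib_right)
  qed
  have Parseval_y: "(\<Sum>j<N. nsq (\<Sum>u\<le>n. cst (inverse (?\<omega> j) ^ u) * y u)) \<le> real N * (?a2 * nsq F)"
  proof -
    have "(\<Sum>j<N. nsq (\<Sum>u\<le>n. cst (inverse (?\<omega> j) ^ u) * y u))
        = (\<Sum>j<N. nsq (\<Sum>u\<le>n. cst (?\<omega> j ^ (0 + N - u)) * y u))"
    proof (intro sum.cong refl arg_cong[of _ _ nsq])
      fix j u assume "u \<in> {..n}"
      then show "cst (inverse (?\<omega> j) ^ u) * y u = cst (?\<omega> j ^ (0 + N - u)) * y u"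
        by (subst root_unity_power_diff) (auto simp: N_def)
    qed
    also have "\<dots> = real N * (\<Sum>r<N. nsq (\<Sum>u\<in>{u \<in> {..n}. (0 + N - u) mod N = r}. y u))"
      using N by (intro Parseval) auto
    also have "(\<Sum>r<N. nsq (\<Sum>u\<in>{u \<in> {..n}. (0 + N - u) mod N = r}. y u)) = (\<Sum>u\<le>n. nsq (y u))"
    proof -
      \<comment> \<open>All \<open>u \<le> n\<close> lie below \<open>N\<close>, so no two of the
        \<open>y u\<close> share a residue; \<open>u = 0\<close> goes to residue 0.\<close>
      have inj: "inj_on (\<lambda>u. (0 + N - u) mod N) {..n}"
      proof (rule inj_onI)
        fix u v assume "u \<in> {..n}" "v \<in> {..n}" and eq: "(0 + N - u) mod N = (0 + N - v) mod N"
        then have "u \<le> n" "v \<le> n" by auto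
        then show "u = v" using eq
          by (cases "u = 0"; cases "v = 0") (auto simp: N_def)
      qed
      have "(\<Sum>r<N. nsq (\<Sum>u\<in>{u \<in> {..n}. (0 + N - u) mod N = r}. y u))
          = (\<Sum>r<N. \<Sum>u\<in>{u \<in> {..n}. (0 + N - u) mod N = r}. nsq (y u))"
      proof (intro sum.cong refl)
        fix r
        define A where "A = {u \<in> {..n}. (0 + N - u) mod N = r}"
        have "A = {} \<or> (\<exists>u. A = {u})"
          using inj unfolding inj_on_def A_def by blast
        then have "nsq (sum y A) = (\<Sum>u\<in>A. nsq (y u))" by auto
        then show "nsq (\<Sum>u\<in>{u \<in> {..n}. (0 + N - u) mod N = r}. y u)
            = (\<Sum>u\<in>{u \<in> {..n}. (0 + N - u) mod N = r}. nsq (y u))" by (simp only: A_def)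
      qed
      also have "\<dots> = (\<Sum>u\<le>n. nsq (y u))"
        using N by (intro sum.group) auto
      finally show ?thesis .
    qed
    also have "(\<Sum>u\<le>n. nsq (y u)) \<le> (\<Sum>u\<le>n. (a u)\<^sup>2 * nsq F)"
      by (intro sum_mono) (simp add: y_def nsq_scale mult_left_mono contractive_power[OF X])
    finally show ?thesis using N by (simp add: sum_distrib_right)
  qed
  have K: "K * nsq f \<ge> 0" for f
    using bnd[of 1] nsq_nonneg order_trans unfolding bnd_def by (metis norm_one)
  have "real N * (\<Sum>v\<le>n. nsq (h v)) \<le> real N * (\<Sum>v<N. nsq (h v))"
    by (intro mult_left_mono sum_mono2) (auto simp: N_def)
  also have "\<dots> = (\<Sum>j<N. nsq (\<Sum>i\<in>I. cst (?\<omega> j ^ \<kappa> i) * z i))"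
    unfolding h_def using N I by (intro Parseval[symmetric])
  \<comment> \<open>The sum over pairs factors at each root of unity, which is where the hypothesis
    with a scalar in place of \<open>X\<close> enters.\<close>
  also have "\<dots> = (\<Sum>j<N. nsq ((\<Sum>m\<in>S. cst (?\<omega> j ^ k m) * c m) * (\<Sum>u\<le>n. cst (inverse (?\<omega> j) ^ u) * y u)))"
  proof (intro sum.cong refl arg_cong[of _ _ nsq])
    fix j
    show "(\<Sum>i\<in>I. cst (?\<omega> j ^ \<kappa> i) * z i)
      = (\<Sum>m\<in>S. cst (?\<omega> j ^ k m) * c m) * (\<Sum>u\<le>n. cst (inverse (?\<omega> j) ^ u) * y u)"
      unfolding sum_product I_def sum.cartesian_product
    proof (intro sum.cong refl)
      fix i assume "i \<in> S \<times> {..n}"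
      then have "snd i \<le> N" by (auto simp: N_def)
      then show "cst (?\<omega> j ^ \<kappa> i) * z i
          = (case i of (m, u) \<Rightarrow> cst (?\<omega> j ^ k m) * c m * (cst (inverse (?\<omega> j) ^ u) * y u))"
        by (simp add: \<kappa>_def z_def root_unity_power_diff cst_mult case_prod_beta mult_ac)
    qed
  qed
  also have "\<dots> \<le> (\<Sum>j<N. K * nsq (\<Sum>u\<le>n. cst (inverse (?\<omega> j) ^ u) * y u))"
    using bnd unfolding bnd_def by (intro sum_mono) simp
  also have "\<dots> = K * (\<Sum>j<N. nsq (\<Sum>u\<le>n. cst (inverse (?\<omega> j) ^ u) * y u))"
    by (simp add: sum_distrib_left)
  also have "\<dots> \<le> real N * (?a2 * K * nsq F)"
  proof (cases "K \<ge> 0")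
    case True
    then show ?thesis using mult_left_mono[OF Parseval_y True] by (simp add: mult_ac)
  next
    case False
    \<comment> \<open>A negative bound is possible only if every vector is null.\<close>
    then have "nsq f = 0" for f
      using K[of f] nsq_nonneg[of f] by (smt (verit) mult_neg_pos)
    then show ?thesis by simp
  qed
  finally have le: "(\<Sum>v\<le>n. nsq (h v)) \<le> ?a2 * K * nsq F"
    using N by simp
  have "nsq (?q * F) \<le> ?b2 * (\<Sum>v\<le>n. nsq (X ^ v * h v))"
    unfolding qF by (intro nsq_weighted_sum_le) simp
  also have "\<dots> \<le> ?b2 * (\<Sum>v\<le>n. nsq (h v))"
    by (intro mult_left_mono sum_mono sum_nonneg contractive_power[OF X]) auto
  also have "\<dots> \<le> ?b2 * (?a2 * K * nsq F)"
    using le by (intro mult_left_mono sum_nonneg) auto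
  finally show "nsq (?q * F) \<le> ?b2 * ?a2 * K * nsq F" by (simp add: mult_ac)
qed

end

text \<open>The power series coefficients of \<open>(1 - x)\<close> to the power \<open>-1/2\<close>.\<close>

definition inv_sqrt_coeff :: "nat \<Rightarrow> real" where
  "inv_sqrt_coeff u = (- 1) ^ u * ((- 1 / 2) gchoose u)"

text \<open>The square of the series is \<open>1 / (1 - x)\<close>, with all coefficients 1; on
  coefficients this is Vandermonde's identity for \<open>- 1 / 2 + - 1 / 2 = - 1\<close>.\<close>

lemma inv_sqrt_coeff_convolution:
  "(\<Sum>u\<le>j. inv_sqrt_coeff (j - u) * inv_sqrt_coeff u) = 1"
proof -
  have "(\<Sum>u\<le>j. inv_sqrt_coeff (j - u) * inv_sqrt_coeff u)
      = (\<Sum>u\<le>j. (- 1) ^ j * (((- 1 / 2) gchoose u) * ((- 1 / 2) gchoose (j - u)) :: real))"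
  proof (intro sum.cong refl)
    fix u assume "u \<in> {..j}"
    then have "(- 1 :: real) ^ j = (- 1) ^ (j - u) * (- 1) ^ u" by (simp flip: power_add)
    then show "inv_sqrt_coeff (j - u) * inv_sqrt_coeff u
      = (- 1) ^ j * (((- 1 / 2) gchoose u) * ((- 1 / 2) gchoose (j - u)) :: real)"
      by (simp add: inv_sqrt_coeff_def)
  qed
  also have "\<dots> = (- 1) ^ j * (((- 1 / 2) + (- 1 / 2)) gchoose j)"
    by (simp only: sum_distrib_left[symmetric] gbinomial_Vandermonde[symmetric] atMost_atLeast0)
  also have "\<dots> = 1"
    by (simp add: gbinomial_minus[of 1, simplified] flip: power_mult_distrib binomial_gbinomial)
  finally show ?thesis .
qed

text \<open>A Wallis-type induction: consecutive coefficients have ratio \<open>a / (a + 1)\<close>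
  with \<open>a = 2 * u + 1\<close>, and \<open>a * (a + 2) \<le> (a + 1)\<^sup>2\<close>.\<close>

lemma inv_sqrt_coeff_sq_le: "(inv_sqrt_coeff u)\<^sup>2 \<le> 1 / real (2 * u + 1)"
proof (induction u)
  case (Suc u)
  have "inv_sqrt_coeff (Suc u) = inv_sqrt_coeff u * ((2 * real u + 1) / (2 * real u + 2))"
    by (simp add: inv_sqrt_coeff_def gbinomial_mult_1 gbinomial_Suc_rec field_simps)
  then have "(inv_sqrt_coeff (Suc u))\<^sup>2 = (inv_sqrt_coeff u)\<^sup>2 * ((2 * real u + 1) / (2 * real u + 2))\<^sup>2"
    by (simp only: power_mult_distrib)
  also have "\<dots> \<le> 1 / real (2 * u + 1) * ((2 * real u + 1) / (2 * real u + 2))\<^sup>2"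
    by (intro mult_right_mono Suc.IH) simp
  also have "\<dots> \<le> 1 / real (2 * Suc u + 1)"
  proof -
    define a where "a = 2 * real u + 1"
    have a: "a > 0" by (simp add: a_def)
    have "1 / a * (a / (a + 1))\<^sup>2 = a / (a + 1)\<^sup>2"
      using a by (simp add: power_divide power2_eq_square)
    also have "\<dots> \<le> 1 / (a + 2)"
    proof -
      have "a * (a + 2) \<le> (a + 1)\<^sup>2" by (simp add: power2_eq_square algebra_simps)
      then have "a \<le> (a + 1)\<^sup>2 / (a + 2)" using a by (simp add: pos_le_divide_eq)
      then show ?thesis using a by (simp add: pos_divide_le_eq)
    qed
    finally show ?thesis by (simp add: a_def add_ac)
  qed
  finally show ?case .
qed (simp add: inv_sqrt_coeff_def)

lemma sum_inv_sqrt_coeff_sq_le: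
  assumes "n \<ge> 1"
  shows "(\<Sum>u\<le>n. (inv_sqrt_coeff u)\<^sup>2) \<le> 3 * ln (real (n + 1))"
proof -
  have "(\<Sum>u\<le>n. (inv_sqrt_coeff u)\<^sup>2) \<le> (\<Sum>u\<le>n. 1 / real (Suc u))"
  proof (intro sum_mono)
    fix u show "(inv_sqrt_coeff u)\<^sup>2 \<le> 1 / real (Suc u)"
      using inv_sqrt_coeff_sq_le[of u] by (rule order_trans) (simp add: field_simps)
  qed
  also have "\<dots> = harm (Suc n)"
    unfolding harm_def lessThan_Suc_atMost[symmetric]
    by (rule sum.reindex_bij_witness[of _ "\<lambda>k. k - 1" Suc]) (auto simp: field_simps)
  \<comment> \<open>The difference of the harmonic number and the logarithm decreases from its
    initial value 1.\<close>
  also have "\<dots> \<le> ln (real (Suc n)) + 1"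
    using decseqD[OF decseq_harm_diff_ln, of 0 n] by (simp add: harm_expand)
  \<comment> \<open>The summand 1 is at most \<open>2 * ln (n + 1)\<close>, because
    \<open>n \<ge> 1\<close> and \<open>ln 2 \<ge> 1 / 2\<close>.\<close>
  also have "\<dots> \<le> 3 * ln (real (n + 1))"
  proof -
    have "1 / 2 \<le> ln (2::real)" using ln2_ge_two_thirds by simp
    also have "\<dots> \<le> ln (real (n + 1))" using assms by simp
    finally show ?thesis by simp
  qed
  finally show ?thesis .
qed

context algebra_form
begin

text \<open>Both halves of the splitting pay the same sum; after square roots the norm grows by that
  sum once.\<close>

lemma bnd_substitute:
  assumes "contractive X" "finite S" "\<And>m. m \<in> S \<Longrightarrow> k m \<le> n"
    and "\<And>\<omega>. cmod \<omega> = 1 \<Longrightarrow> bnd K (\<Sum>m\<in>S. cst (\<omega> ^ k m) * c m)"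
  shows "bnd ((\<Sum>u\<le>n. (inv_sqrt_coeff u)\<^sup>2)\<^sup>2 * K) (\<Sum>m\<in>S. c m * X ^ k m)"
  using bnd_weighted[OF assms, of "\<lambda>_. 1" inv_sqrt_coeff inv_sqrt_coeff]
  by (simp add: inv_sqrt_coeff_convolution power2_eq_square)

text \<open>The weight \<open>j\<close> counts the splittings of \<open>j\<close> with
  \<open>1 \<le> u \<le> j\<close>, for which \<open>j - u < n\<close> is automatic. The cutoffs
  leave exactly \<open>n\<close> ones on either side, matching the \<open>n\<close> in Euler's
  identity.\<close>

lemma bnd_Euler:
  assumes "contractive X" "finite S" "\<And>m. m \<in> S \<Longrightarrow> k m \<le> n"
    and "\<And>\<omega>. cmod \<omega> = 1 \<Longrightarrow> bnd K (\<Sum>m\<in>S. cst (\<omega> ^ k m) * c m)"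
  shows "bnd ((real n)\<^sup>2 * K) (\<Sum>m\<in>S. cst (of_nat (k m)) * c m * X ^ k m)"
proof -
  let ?b = "\<lambda>v. if v < n then 1 else 0 :: real" and ?a = "\<lambda>u. if u \<ge> 1 then 1 else 0 :: real"
  have "real j = (\<Sum>u\<le>j. ?b (j - u) * ?a u)" if "j \<le> n" for j
  proof -
    have "(\<Sum>u\<le>j. ?b (j - u) * ?a u) = (\<Sum>u\<in>{1..j}. 1)"
      using that by (intro sum.mono_neutral_cong_right) auto
    then show ?thesis by simp
  qed
  note bnd_weighted[OF assms this]
  moreover have "(\<Sum>v\<le>n. (?b v)\<^sup>2) = (\<Sum>v\<in>{..<n}. 1)" "(\<Sum>u\<le>n. (?a u)\<^sup>2) = (\<Sum>u\<in>{1..n}. 1)"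
    by (intro sum.mono_neutral_cong_right; auto)+
  ultimately show ?thesis by (simp add: power2_eq_square)
qed

end

section \<open>Two commuting contractions\<close>

locale contractive_pair = algebra_form +
  fixes X Y :: "'a"
  assumes X: "contractive X" and Y: "contractive Y"
begin

text \<open>The form of the squared defect operator of \<open>Z\<close>, positive semidefinite when
  \<open>Z\<close> is contractive.\<close>

definition defect :: "'a \<Rightarrow> 'a \<Rightarrow> 'a \<Rightarrow> complex" where
  "defect Z f g = B f g - B (Z * f) (Z * g)"

lemma semi_inner_defect:
  assumes "contractive Z" shows "semi_inner (\<lambda>c f. cst c * f) (defect Z)"
proof (unfold_locales, goal_cases)
  case (2 c x y)
  have "Z * (cst c * x) = cst c * (Z * x)" by (rule mult.left_commute)
  then show ?case by (simp only: defect_def B_scale_left right_diff_distrib)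
next
  case (3 x y)
  then show ?case
    using B_commute[of x y] B_commute[of "Z * x" "Z * y"] by (simp add: defect_def)
next
  case (4 x)
  then show ?case using assms by (simp add: defect_def bnd_def nsq_def)
qed (auto simp: defect_def B_add_left B_scale_left algebra_simps)

text \<open>Ando's lifting in the form of Berger, Coburn and Lebow.  The space \<open>E\<close> is the sum of the two defect
  spaces and \<open>K\<close> is the base space plus sequences in \<open>E\<close>.  \<open>Phi1\<close> and \<open>Phi2\<close> are
  isometric lifts of \<open>X\<close> and \<open>Y\<close>; if \<open>G\<close> is an isometry of \<open>E\<close> with
  \<open>G (Y h, h) = (h, X h)\<close>, then \<open>V1 = G Phi1\<close> and \<open>V2 = Phi2 G\<^sup>-\<^sup>1\<close> also commute.  The form
  only counts the first \<open>L\<close> entries of a sequence, so the lifts are isometric only on short sequences,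
  and all identities hold up to vectors of seminorm 0.\<close>

definition scE where "scE c p = (cst c * fst p, cst c * snd p)"
definition BE where "BE p q = defect X (fst p) (fst q) + defect Y (snd p) (snd q)"

sublocale E: semi_inner scE BE
  using semi_inner_prod[OF semi_inner_defect[OF X] semi_inner_defect[OF Y]]
  unfolding scE_def BE_def .

definition scK where "scK c k = (cst c * fst k, \<lambda>j::nat. scE c (snd k j))"
definition BK where "BK L k k' = B (fst k) (fst k') + (\<Sum>j<L. BE (snd k j) (snd k' j))"

sublocale K: semi_inner scK "BK L" for L
  using semi_inner_prod[OF semi_inner_axioms semi_inner_fun[OF E.semi_inner_axioms, of L]]
  unfolding scK_def BK_def .

abbreviation nsqK where "nsqK \<equiv> K.nsq"

lemma nsqE: "E.nsq p = (nsq (fst p) - nsq (X * fst p)) + (nsq (snd p) - nsq (Y * snd p))"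
  by (simp add: E.nsq_def BE_def defect_def nsq_def)

lemma nsqK: "nsqK L k = nsq (fst k) + (\<Sum>j<L. E.nsq (snd k j))"
  by (simp add: K.nsq_def BK_def nsq_def E.nsq_def)

text \<open>Schaeffer's isometric lift of \<open>X\<close>, extended by the identity on the other
  defect component so that both lifts act on one space.\<close>

definition Phi1 where
  "Phi1 k = (X * fst k, \<lambda>j. (case j of 0 \<Rightarrow> fst k | Suc i \<Rightarrow> fst (snd k i), snd (snd k j)))"
definition Phi2 where
  "Phi2 k = (Y * fst k, \<lambda>j. (fst (snd k j), case j of 0 \<Rightarrow> fst k | Suc i \<Rightarrow> snd (snd k i)))"
text \<open>The base coordinate is left alone, so the twisted maps still lift \<open>X\<close> and
  \<open>Y\<close>.\<close>

definition gauge where "gauge G k = (fst k, \<lambda>j. G (snd k j))"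

definition supp where "supp l k \<longleftrightarrow> (\<forall>j\<ge>l. snd k j = 0)"

text \<open>The defect stored at the head compensates what \<open>X\<close> loses on the base; only
  the entry shifted out of the counted window is missing.\<close>

lemma nsqK_Phi1: "nsqK (Suc L) (Phi1 k) = nsqK (Suc L) k - (nsq (fst (snd k L)) - nsq (X * fst (snd k L)))"
  unfolding nsqK nsqE sum.distrib
  by (subst (1) sum.lessThan_Suc_shift) (simp add: Phi1_def)

lemma nsqK_Phi2: "nsqK (Suc L) (Phi2 k) = nsqK (Suc L) k - (nsq (snd (snd k L)) - nsq (Y * snd (snd k L)))"
  unfolding nsqK nsqE sum.distrib
  by (subst (2) sum.lessThan_Suc_shift) (simp add: Phi2_def)

text \<open>Valid without a support condition, so the lifts send null vectors to null
  vectors.\<close>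

lemma nsqK_Phi_le: "nsqK (Suc L) (Phi1 k) \<le> nsqK (Suc L) k" "nsqK (Suc L) (Phi2 k) \<le> nsqK (Suc L) k"
  using X Y by (simp_all add: nsqK_Phi1 nsqK_Phi2 bnd_def)

lemma nsqK_Phi_eq:
  assumes "supp L k"
  shows "nsqK (Suc L) (Phi1 k) = nsqK (Suc L) k" "nsqK (Suc L) (Phi2 k) = nsqK (Suc L) k"
  using assms by (simp_all add: nsqK_Phi1 nsqK_Phi2 supp_def)

lemma linear_Phi: "Vector_Spaces.linear scK scK Phi1" "Vector_Spaces.linear scK scK Phi2"
  by (auto simp: Vector_Spaces.linear_iff K.vector_space_axioms Phi1_def Phi2_def scK_def scE_def
      fun_eq_iff algebra_simps prod_eq_iff split: nat.split)

lemma supp_Phi: "supp l k \<Longrightarrow> supp (Suc l) (Phi1 k)" "supp l k \<Longrightarrow> supp (Suc l) (Phi2 k)"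
  by (auto simp: supp_def Phi1_def Phi2_def zero_prod_def split: nat.split)

lemma linear_gauge:
  assumes "Vector_Spaces.linear scE scE G"
  shows "Vector_Spaces.linear scK scK (gauge G)"
proof -
  interpret G: Vector_Spaces.linear scE scE G by (rule assms)
  show ?thesis
    by (simp add: Vector_Spaces.linear_iff K.vector_space_axioms gauge_def scK_def fun_eq_iff
      G.add G.scale)
qed

lemma supp_gauge:
  assumes "Vector_Spaces.linear scE scE G" "supp l k"
  shows "supp l (gauge G k)"
proof -
  interpret G: Vector_Spaces.linear scE scE G by (rule assms)
  show ?thesis using assms(2) by (simp add: supp_def gauge_def G.zero)
qed

lemma nsqK_gauge: "(\<And>p. E.nsq (G p) = E.nsq p) \<Longrightarrow> nsqK L (gauge G k) = nsqK L k"
  by (simp add: nsqK gauge_def)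

text \<open>Both orders shift each component once, so \<open>G\<close> and \<open>G'\<close> cancel
  beyond the head. The heads are \<open>(fst k, X * fst k)\<close> and
  \<open>G (Y * fst k, fst k)\<close>, which the assumption on \<open>G\<close> identifies up to a
  null vector.\<close>

lemma Phi_commute:
  assumes G: "\<And>p. G (G' p) = p" "\<And>p. G' (G p) = p"
    and k: "E.nsq (G (Y * fst k, fst k) - (fst k, X * fst k)) = 0"
  shows "nsqK L (Phi2 (gauge G' (gauge G (Phi1 k))) - gauge G (Phi1 (Phi2 (gauge G' k)))) = 0"
proof -
  let ?d = "gauge G (Phi1 (Phi2 (gauge G' k))) - Phi2 (gauge G' (gauge G (Phi1 k)))"
  have "fst ?d = 0" by (simp add: gauge_def Phi1_def Phi2_def mult_ac)
  moreover have "E.nsq (snd ?d j) = 0" for j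
  proof (cases j)
    case 0
    then show ?thesis using k by (simp add: gauge_def Phi1_def Phi2_def G)
  next
    case (Suc i)
    then show ?thesis by (simp add: gauge_def Phi1_def Phi2_def G)
  qed
  ultimately have "nsqK L ?d = 0" by (simp add: nsqK)
  then show ?thesis using K.nsq_minus[of L ?d] by simp
qed

text \<open>A dimension-free inequality with norm constant 2. The \<open>F i j\<close> are an orbit
  of \<open>f\<close> under two isometries that commute up to null vectors while exponents stay
  small. Translating \<open>q\<close> along the orbit keeps its norm, and averaging over translates
  leads to \<open>array_average\<close>.\<close>

lemma bnd_two_variables:
  assumes S: "finite S" and n: "n > 0"
    and k: "\<And>s. s \<in> S \<Longrightarrow> k s \<le> n" and l: "\<And>s. s \<in> S \<Longrightarrow> l s \<le> n"
    and M: "\<And>\<omega> \<omega>'. \<lbrakk>cmod \<omega> = 1; cmod \<omega>' = 1\<rbrakk> \<Longrightarrow> cmod (\<Sum>s\<in>S. a s * \<omega> ^ k s * \<omega>' ^ l s) \<le> M"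
  shows "bnd (4 * M\<^sup>2) (\<Sum>s\<in>S. cst (a s) * X ^ k s * Y ^ l s)"
  unfolding bnd_def
proof
  fix f
  \<comment> \<open>All exponent pairs used sum to less than \<open>4 * n\<close>, so the supports
    never reach the end of the window.\<close>
  define L where "L = 4 * n"
  define x where "x i j = X ^ i * (Y ^ j * f)" for i j
  define N where "N = n + n"
  let ?I = "{..<N} \<times> {..<N}"
  \<comment> \<open>Both sides telescope to \<open>B f g - B (X * Y * f) (X * Y * g)\<close> for the
    two vectors \<open>f\<close>, \<open>g\<close> involved.\<close>
  have gram: "BE (Y * x i j, x i j) (Y * x i' j', x i' j') = BE (x i j, X * x i j) (x i' j', X * x i' j')"
    for i j i' j'
    by (simp add: BE_def defect_def mult.left_commute[of X Y])
  obtain G G' where G: "Vector_Spaces.linear scE scE G" "Vector_Spaces.linear scE scE G'"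
      "\<And>p. G (G' p) = p" "\<And>p. G' (G p) = p" "\<And>p. E.nsq (G p) = E.nsq p"
    and G0: "\<And>i. i \<in> ?I \<Longrightarrow> E.nsq (G (Y * x (fst i) (snd i), x (fst i) (snd i)) - (x (fst i) (snd i), X * x (fst i) (snd i))) = 0"
    using E.exists_isometry[of ?I "\<lambda>i. (Y * x (fst i) (snd i), x (fst i) (snd i))"
        "\<lambda>i. (x (fst i) (snd i), X * x (fst i) (snd i))"] gram by auto
  have G'_iso: "E.nsq (G' p) = E.nsq p" for p
    using G(5)[of "G' p"] by (simp add: G(3))
  define V1 where "V1 = gauge G \<circ> Phi1"
  define V2 where "V2 = Phi2 \<circ> gauge G'"
  interpret V1: Vector_Spaces.linear scK scK V1
    unfolding V1_def by (rule Vector_Spaces.linear_compose[OF linear_Phi(1) linear_gauge[OF G(1)]])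
  interpret V2: Vector_Spaces.linear scK scK V2
    unfolding V2_def by (rule Vector_Spaces.linear_compose[OF linear_gauge[OF G(2)] linear_Phi(2)])
  have suppV: "supp (Suc r) (V1 p)" "supp (Suc r) (V2 p)" if "supp r p" for r p
    using that by (simp_all add: V1_def V2_def supp_gauge G supp_Phi)
  have V_le: "nsqK (Suc L) (V1 p) \<le> nsqK (Suc L) p" "nsqK (Suc L) (V2 p) \<le> nsqK (Suc L) p" for p
    using nsqK_Phi_le(1)[of L p] nsqK_Phi_le(2)[of L "gauge G' p"]
    by (simp_all add: V1_def V2_def nsqK_gauge G G'_iso)
  have V_eq: "nsqK (Suc L) (V1 p) = nsqK (Suc L) p" "nsqK (Suc L) (V2 p) = nsqK (Suc L) p"
    if "supp r p" "r \<le> L" for p r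
  proof -
    have "supp L p" using that by (simp add: supp_def)
    then show "nsqK (Suc L) (V1 p) = nsqK (Suc L) p" "nsqK (Suc L) (V2 p) = nsqK (Suc L) p"
      by (simp_all add: V1_def V2_def nsqK_gauge G G'_iso nsqK_Phi_eq supp_gauge)
  qed
  have fstV: "fst (V1 p) = X * fst p" "fst (V2 p) = Y * fst p" for p
    by (simp_all add: V1_def V2_def gauge_def Phi1_def Phi2_def)
  define eqK (infix "\<doteq>" 50) where "p \<doteq> q \<longleftrightarrow> nsqK (Suc L) (p - q) = 0" for p q
  have refl: "p \<doteq> p" for p by (simp add: eqK_def)
  have trans [trans]: "p \<doteq> q \<Longrightarrow> q \<doteq> r \<Longrightarrow> p \<doteq> r" for p q r
    unfolding eqK_def by (rule K.null_diff_trans)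
  have V_cong: "V1 p \<doteq> V1 q" "V2 p \<doteq> V2 q" if "p \<doteq> q" for p q
    using that V_le[of "p - q"] K.nsq_nonneg[of "Suc L"] unfolding eqK_def
    by (metis V1.diff order_antisym, metis V2.diff order_antisym)
  define F where "F i j = (V1 ^^ i) ((V2 ^^ j) (f, \<lambda>_. 0))" for i j
  have suppF: "supp (i + j) (F i j)" for i j
  proof -
    have "supp j ((V2 ^^ j) (f, \<lambda>_. 0))"
      by (induction j) (use suppV in \<open>auto simp: supp_def\<close>)
    then have "supp (j + i) (F i j)"
      unfolding F_def by (induction i) (use suppV in auto)
    then show ?thesis by (simp add: add.commute)
  qed
  have fstF: "fst (F i j) = x i j" for i j
  proof -
    have "fst ((V2 ^^ j) (f, \<lambda>_. 0)) = Y ^ j * f"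
      by (induction j) (simp_all add: fstV mult.assoc)
    then show ?thesis
      unfolding F_def by (induction i) (simp_all add: fstV x_def mult.assoc)
  qed
  \<comment> \<open>\<open>V2\<close> passes the factors \<open>V1\<close> one at a time;
    \<open>G\<close> is controlled only at the base vectors \<open>x i j\<close> with
    \<open>i, j < N\<close>, whence the bounds.\<close>
  have step: "V2 (F i j) \<doteq> F i (Suc j)" if "i < N" "j < N" for i j
    using that
  proof (induction i)
    case 0
    then show ?case by (simp add: F_def refl)
  next
    case (Suc i)
    have "V2 (V1 (F i j)) \<doteq> V1 (V2 (F i j))"
      using Phi_commute[OF G(3,4), of "F i j" "Suc L"] G0[of "(i, j)"] Suc.prems
      by (simp add: eqK_def V1_def V2_def fstF)
    also have "\<dots> \<doteq> V1 (F i (Suc j))"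
      using Suc by (intro V_cong) auto
    finally show ?case by (simp add: F_def)
  qed
  have steps: "(V1 ^^ g) ((V2 ^^ g') (F i j)) \<doteq> F (i + g) (j + g')" if "i < N" "j + g' < N" for i j g g'
  proof -
    have "(V2 ^^ g') (F i j) \<doteq> F i (j + g')"
      using that(2)
    proof (induction g')
      case (Suc g')
      have "V2 ((V2 ^^ g') (F i j)) \<doteq> V2 (F i (j + g'))"
        using Suc by (intro V_cong) auto
      also have "\<dots> \<doteq> F i (Suc (j + g'))"
        using Suc.prems that(1) by (intro step) auto
      finally show ?case by simp
    qed (simp add: refl)
    then have "(V1 ^^ g) ((V2 ^^ g') (F i j)) \<doteq> (V1 ^^ g) (F i (j + g'))"
      by (induction g) (auto intro: V_cong)
    also have "(V1 ^^ g) (F i (j + g')) = F (i + g) (j + g')"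
      by (simp add: F_def funpow_add add.commute[of i])
    finally show ?thesis .
  qed
  have V_pow: "nsqK (Suc L) ((V1 ^^ g) ((V2 ^^ g') p)) = nsqK (Suc L) p"
    if "supp r p" "r + g + g' \<le> L" for p r g g'
  proof -
    have *: "supp (r + g') ((V2 ^^ g') p) \<and> nsqK (Suc L) ((V2 ^^ g') p) = nsqK (Suc L) p"
      using that(2)
    proof (induction g')
      case (Suc g')
      then show ?case using suppV(2)[of "r + g'" "(V2 ^^ g') p"] V_eq(2)[of "r + g'" "(V2 ^^ g') p"]
        by simp
    qed (simp add: that)
    have "supp (r + g' + g) ((V1 ^^ g) ((V2 ^^ g') p)) \<and>
        nsqK (Suc L) ((V1 ^^ g) ((V2 ^^ g') p)) = nsqK (Suc L) p"
      using that(2)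
    proof (induction g)
      case (Suc g)
      then show ?case using suppV(1)[of "r + g' + g" "(V1 ^^ g) ((V2 ^^ g') p)"]
          V_eq(1)[of "r + g' + g" "(V1 ^^ g) ((V2 ^^ g') p)"]
        by simp
    qed (simp add: *)
    then show ?thesis ..
  qed
  define q where "q = (\<Sum>s\<in>S. scK (a s) (F (k s) (l s)))"
  have fst_q: "fst q = (\<Sum>s\<in>S. cst (a s) * X ^ k s * Y ^ l s) * f"
    by (simp add: q_def fst_sum sum_distrib_right scK_def fstF x_def mult.assoc)
  have supp_q: "supp (n + n) q"
    unfolding supp_def
  proof (intro allI impI)
    fix j assume j: "n + n \<le> j"
    have "snd q j = (\<Sum>s\<in>S. scE (a s) (snd (F (k s) (l s)) j))"
      unfolding q_def by (induction S rule: infinite_finite_induct) (simp_all add: scK_def)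
    also have "\<dots> = 0"
    proof (intro sum.neutral ballI)
      fix s assume "s \<in> S"
      then have "k s + l s \<le> j" using k[of s] l[of s] j by linarith
      then show "scE (a s) (snd (F (k s) (l s)) j) = 0"
        using suppF[of "k s" "l s"] by (simp add: supp_def)
    qed
    finally show "snd q j = 0" .
  qed
  have shift: "nsqK (Suc L) (\<Sum>s\<in>S. scK (a s) (F (g + k s) (g' + l s))) = nsqK (Suc L) q"
    if "g < n" "g' < n" for g g'
  proof -
    have pow: "(V1 ^^ g) ((V2 ^^ g') q) = (\<Sum>s\<in>S. scK (a s) ((V1 ^^ g) ((V2 ^^ g') (F (k s) (l s)))))"
    proof -
      have "(V2 ^^ g') q = (\<Sum>s\<in>S. scK (a s) ((V2 ^^ g') (F (k s) (l s))))"
        by (induction g') (simp_all add: q_def V2.sum V2.scale)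
      then show ?thesis
        by (induction g) (simp_all add: V1.sum V1.scale)
    qed
    have "(\<Sum>s\<in>S. scK (a s) ((V1 ^^ g) ((V2 ^^ g') (F (k s) (l s)))))
        \<doteq> (\<Sum>s\<in>S. scK (a s) (F (g + k s) (g' + l s)))"
      unfolding eqK_def sum_subtractf[symmetric] K.scale_right_diff_distrib[symmetric]
    proof (intro K.null_sum)
      fix s assume "s \<in> S"
      then have "k s < N" "l s + g' < N" using k[of s] l[of s] that n by (auto simp: N_def)
      then have "nsqK (Suc L) ((V1 ^^ g) ((V2 ^^ g') (F (k s) (l s))) - F (g + k s) (g' + l s)) = 0"
        unfolding eqK_def[symmetric] add.commute[of g] add.commute[of g'] by (rule steps)
      then show "nsqK (Suc L) (scK (a s) ((V1 ^^ g) ((V2 ^^ g') (F (k s) (l s))) - F (g + k s) (g' + l s))) = 0"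
        by (simp add: K.nsq_scale)
    qed
    then have "nsqK (Suc L) (\<Sum>s\<in>S. scK (a s) (F (g + k s) (g' + l s))) = nsqK (Suc L) ((V1 ^^ g) ((V2 ^^ g') q))"
      unfolding pow eqK_def by (rule K.nsq_diff_null[symmetric])
    also have "\<dots> = nsqK (Suc L) q"
      using that by (intro V_pow[OF supp_q]) (simp add: L_def)
    finally show ?thesis .
  qed
  have nsqF: "nsqK (Suc L) (F g g') = nsq f" if "g < N" "g' < N" for g g'
  proof -
    have "nsqK (Suc L) (F g g') = nsqK (Suc L) (f, \<lambda>_. 0)"
      unfolding F_def using that by (intro V_pow[of 0]) (auto simp: supp_def L_def N_def)
    then show ?thesis by (simp add: nsqK)
  qed
  have "(real n)\<^sup>2 * nsqK (Suc L) q = (\<Sum>g<n. \<Sum>g'<n. nsqK (Suc L) (\<Sum>s\<in>S. scK (a s) (F (g + k s) (g' + l s))))"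
    by (simp add: shift power2_eq_square)
  also have "\<dots> \<le> M\<^sup>2 * (\<Sum>g<N. \<Sum>g'<N. nsqK (Suc L) (F g g'))"
    using S k l M N_def n by (rule K.array_average)
  \<comment> \<open>The array has \<open>(2 * n)\<^sup>2\<close> entries of the norm of
    \<open>f\<close>, against \<open>n\<^sup>2\<close> translates of \<open>q\<close>: hence the
    factor 4.\<close>
  also have "\<dots> = (real n)\<^sup>2 * (4 * M\<^sup>2 * nsq f)"
    by (simp add: nsqF N_def power2_eq_square)
  finally have "nsqK (Suc L) q \<le> 4 * M\<^sup>2 * nsq f"
    using n by simp
  moreover have "nsq (fst q) \<le> nsqK (Suc L) q"
    unfolding nsqK by (simp add: sum_nonneg)
  ultimately show "nsq ((\<Sum>s\<in>S. cst (a s) * X ^ k s * Y ^ l s) * f) \<le> 4 * M\<^sup>2 * nsq f"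
    unfolding fst_q by linarith
qed

end

section \<open>Homogeneous polynomials in several contractions\<close>

text \<open>The supremum is over the open polydisc; torus points are reached as radial
  limits.\<close>

lemma cmod_poly_eval_le:
  assumes "\<And>i. i < d \<Longrightarrow> cmod (z i) = 1"
  shows "cmod (poly_eval d p z) \<le> polydisc_norm d p"
proof -
  define f where "f r = poly_eval d p (\<lambda>i. of_real r * z i)" for r :: real
  have "(f \<longlongrightarrow> f 1) (at_left 1)"
    unfolding f_def poly_eval_def by (intro tendsto_intros)
  then have "((\<lambda>r. cmod (f r)) \<longlongrightarrow> cmod (f 1)) (at_left 1)"
    by (rule tendsto_norm)
  moreover have "\<forall>\<^sub>F r in at_left 1. cmod (f r) \<le> polydisc_norm d p"
  proof (rule eventually_at_leftI[of 0])
    fix r :: real assume "r \<in> {0<..<1}"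
    then have "(\<lambda>i\<in>{..<d}. of_real r * z i) \<in> polydisc d"
      using assms by (auto simp: polydisc_def norm_mult)
    moreover have "poly_eval d p (\<lambda>i\<in>{..<d}. of_real r * z i) = f r"
      by (simp add: f_def poly_eval_def)
    ultimately show "cmod (f r) \<le> polydisc_norm d p"
      by (metis poly_eval_le)
  qed simp
  ultimately have "cmod (f 1) \<le> polydisc_norm d p"
    by (intro tendsto_upperbound) auto
  then show ?thesis by (simp add: f_def)
qed

context algebra_form
begin

lemma cst_power: "cst (a ^ k) = cst a ^ k"
  by (induction k) (simp_all add: cst_mult)

lemma cst_prod: "cst (\<Prod>i\<in>A. f i) = (\<Prod>i\<in>A. cst (f i))"
  by (induction A rule: infinite_finite_induct) (simp_all add: cst_mult)

text \<open>Entries of \<open>z\<close> may mix contractive elements with constants, as replacing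
  them one by one requires.\<close>

definition subst_poly :: "nat \<Rightarrow> cpoly \<Rightarrow> (nat \<Rightarrow> 'r) \<Rightarrow> 'r" where
  "subst_poly d p z = (\<Sum>m\<in>Poly_Mapping.keys p.
     cst (Poly_Mapping.lookup p m) * (\<Prod>i<d. z i ^ Poly_Mapping.lookup m i))"

lemma prod_power_remove:
  fixes z :: "nat \<Rightarrow> 'c::comm_monoid_mult"
  shows "s < d \<Longrightarrow> (\<Prod>i<d. z i ^ k i) = z s ^ k s * (\<Prod>i\<in>{..<d} - {s}. z i ^ k i)"
  by (intro prod.remove) auto

text \<open>Turns the sums in the hypotheses of \<open>bnd_substitute\<close> and
  \<open>bnd_Euler\<close> into the same polynomial with \<open>z s\<close> frozen at
  \<omega>.\<close>

lemma subst_poly_upd: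
  assumes "s < d"
  shows "(\<Sum>m\<in>Poly_Mapping.keys p. cst (\<omega> ^ Poly_Mapping.lookup m s) *
      (cst (Poly_Mapping.lookup p m) * (\<Prod>i\<in>{..<d} - {s}. z i ^ Poly_Mapping.lookup m i)))
    = subst_poly d p (z(s := cst \<omega>))"
  unfolding subst_poly_def
  by (intro sum.cong refl) (simp add: prod_power_remove[OF assms] cst_power mult_ac)

lemma bnd_subst_two:
  assumes n: "n > 0" and deg: "\<And>m i. \<lbrakk>m \<in> Poly_Mapping.keys p; i < d\<rbrakk> \<Longrightarrow> Poly_Mapping.lookup m i \<le> n"
    and ij: "i < d" "j < d" "i \<noteq> j" and "contractive (z i)" "contractive (z j)"
    and z: "\<And>k. \<lbrakk>k < d; k \<noteq> i; k \<noteq> j\<rbrakk> \<Longrightarrow> z k = cst (u k) \<and> cmod (u k) = 1"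
  shows "bnd (4 * (polydisc_norm d p)\<^sup>2) (subst_poly d p z)"
proof -
  interpret contractive_pair cst B "z i" "z j"
    by unfold_locales fact+
  let ?l = Poly_Mapping.lookup
  let ?A = "{..<d} - {i} - {j}"
  define a where "a m = ?l p m * (\<Prod>k\<in>?A. u k ^ ?l m k)" for m
  have prod_split: "(\<Prod>k<d. y k ^ ?l m k) = y i ^ ?l m i * (y j ^ ?l m j * (\<Prod>k\<in>?A. y k ^ ?l m k))"
    for m and y :: "nat \<Rightarrow> 'c::comm_monoid_mult"
    using ij by (subst prod_power_remove[of i]) (simp_all add: prod.remove[of "{..<d} - {i}" j])
  have "bnd (4 * (polydisc_norm d p)\<^sup>2)
      (\<Sum>m\<in>Poly_Mapping.keys p. cst (a m) * z i ^ ?l m i * z j ^ ?l m j)"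
  proof (rule bnd_two_variables[OF _ n])
    fix v w :: complex assume vw: "cmod v = 1" "cmod w = 1"
    have "(\<Sum>m\<in>Poly_Mapping.keys p. a m * v ^ ?l m i * w ^ ?l m j)
        = poly_eval d p (u(i := v, j := w))"
      unfolding poly_eval_def prod_split a_def using ij
      by (intro sum.cong refl) (auto simp: mult_ac intro!: prod.cong)
    also have "cmod \<dots> \<le> polydisc_norm d p"
      using z vw by (intro cmod_poly_eval_le) auto
    finally show "cmod (\<Sum>m\<in>Poly_Mapping.keys p. a m * v ^ ?l m i * w ^ ?l m j) \<le> polydisc_norm d p" .
  qed (use deg ij in auto)
  also have "(\<Sum>m\<in>Poly_Mapping.keys p. cst (a m) * z i ^ ?l m i * z j ^ ?l m j) = subst_poly d p z"
    unfolding subst_poly_def prod_split a_def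
    by (intro sum.cong refl) (simp add: cst_mult cst_prod cst_power z mult_ac)
  finally show ?thesis .
qed

text \<open>\<open>A\<close> holds the variables that are still operators. Each one beyond two is
  removed by \<open>bnd_substitute\<close>.\<close>

lemma bnd_subst:
  assumes n: "n > 0" and deg: "\<And>m i. \<lbrakk>m \<in> Poly_Mapping.keys p; i < d\<rbrakk> \<Longrightarrow> Poly_Mapping.lookup m i \<le> n"
    and A: "A \<subseteq> {..<d}" "card A = r + 2"
    and "\<And>i. i \<in> A \<Longrightarrow> contractive (z i)"
    and "\<And>i. i \<in> {..<d} - A \<Longrightarrow> z i = cst (u i) \<and> cmod (u i) = 1"
  shows "bnd (((\<Sum>u\<le>n. (inv_sqrt_coeff u)\<^sup>2)\<^sup>2) ^ r * (4 * (polydisc_norm d p)\<^sup>2)) (subst_poly d p z)"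
  using A assms(5,6)
proof (induction r arbitrary: A z u)
  case 0
  then have "card A = 2" by simp
  then obtain i j where "A = {i, j}" "i \<noteq> j"
    by (auto simp: card_2_iff)
  then show ?case
    using 0 bnd_subst_two[OF n deg, where i = i and j = j and z = z and u = u] by simp
next
  case (Suc r)
  let ?l = Poly_Mapping.lookup
  obtain s where s: "s \<in> A" using Suc.prems(2) by fastforce
  have s': "s < d" and fin: "finite A"
    using s Suc.prems(1) finite_subset by auto
  have "bnd ((\<Sum>u\<le>n. (inv_sqrt_coeff u)\<^sup>2)\<^sup>2
      * (((\<Sum>u\<le>n. (inv_sqrt_coeff u)\<^sup>2)\<^sup>2) ^ r * (4 * (polydisc_norm d p)\<^sup>2)))
    (\<Sum>m\<in>Poly_Mapping.keys p. (cst (?l p m) * (\<Prod>i\<in>{..<d} - {s}. z i ^ ?l m i)) * z s ^ ?l m s)"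
  proof (rule bnd_substitute)
    fix v :: complex assume v: "cmod v = 1"
    show "bnd (((\<Sum>u\<le>n. (inv_sqrt_coeff u)\<^sup>2)\<^sup>2) ^ r * (4 * (polydisc_norm d p)\<^sup>2))
      (\<Sum>m\<in>Poly_Mapping.keys p. cst (v ^ ?l m s) * (cst (?l p m) * (\<Prod>i\<in>{..<d} - {s}. z i ^ ?l m i)))"
      unfolding subst_poly_upd[OF s']
    proof (rule Suc.IH)
      show "A - {s} \<subseteq> {..<d}" "card (A - {s}) = r + 2"
        using Suc.prems(1,2) s fin by auto
      show "contractive ((z(s := cst v)) i)" if "i \<in> A - {s}" for i
        using Suc.prems(3)[of i] that by simp
      show "(z(s := cst v)) i = cst ((u(s := v)) i) \<and> cmod ((u(s := v)) i) = 1"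
        if "i \<in> {..<d} - (A - {s})" for i
        using Suc.prems(4)[of i] that v by (cases "i = s") simp_all
    qed
  qed (use Suc.prems(3) s s' deg in simp_all)
  also have "(\<Sum>m\<in>Poly_Mapping.keys p. (cst (?l p m) * (\<Prod>i\<in>{..<d} - {s}. z i ^ ?l m i)) * z s ^ ?l m s)
      = subst_poly d p z"
    unfolding subst_poly_def by (simp add: prod_power_remove[OF s'] mult_ac)
  finally show ?case by (simp add: mult.assoc)
qed

lemma bnd_homogeneous:
  assumes n: "n > 0" and p: "homogeneous_poly d n p" and d: "d = r + 3"
    and z: "\<And>i. i < d \<Longrightarrow> contractive (z i)"
  shows "bnd ((real d)\<^sup>2 * (((\<Sum>u\<le>n. (inv_sqrt_coeff u)\<^sup>2)\<^sup>2) ^ r * (4 * (polydisc_norm d p)\<^sup>2)))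
    (subst_poly d p z)" (is "bnd (_ * ?K) _")
  unfolding bnd_def
proof
  fix f
  let ?l = Poly_Mapping.lookup
  have deg: "?l m i \<le> n" if "m \<in> Poly_Mapping.keys p" "i < d" for m i
    using that p member_le_sum[of i "{..<d}" "?l m"] by (auto simp: homogeneous_poly_def)
  define q where "q s = (\<Sum>m\<in>Poly_Mapping.keys p. cst (of_nat (?l m s)) *
      (cst (?l p m) * (\<Prod>i\<in>{..<d} - {s}. z i ^ ?l m i)) * z s ^ ?l m s)" for s
  have bnd_q: "bnd ((real n)\<^sup>2 * ?K) (q s)" if s: "s < d" for s
    unfolding q_def
  proof (rule bnd_Euler)
    fix v :: complex assume v: "cmod v = 1"
    show "bnd ?K (\<Sum>m\<in>Poly_Mapping.keys p. cst (v ^ ?l m s) * (cst (?l p m) * (\<Prod>i\<in>{..<d} - {s}. z i ^ ?l m i)))"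
      unfolding subst_poly_upd[OF s]
      \<comment> \<open>Only \<open>z s\<close> is scalar, so \<open>r + 2\<close> contractions
        remain and \<open>u\<close> may be constant.\<close>
      using s v z d by (intro bnd_subst[OF n deg, where A = "{..<d} - {s}" and u = "\<lambda>_. v"]) auto
  qed (use s deg z in auto)
  \<comment> \<open>Euler's identity, \<open>q s\<close> being \<open>z s\<close> times the partial
    derivative in that variable.\<close>
  have "cst (of_nat n) * subst_poly d p z = (\<Sum>s<d. q s)"
  proof -
    have "cst (of_nat n) * subst_poly d p z
        = (\<Sum>m\<in>Poly_Mapping.keys p. \<Sum>s<d. cst (of_nat (?l m s)) * (cst (?l p m) * (\<Prod>i<d. z i ^ ?l m i)))"
      unfolding subst_poly_def sum_distrib_left
    proof (intro sum.cong refl)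
      fix m assume "m \<in> Poly_Mapping.keys p"
      then have "(of_nat n :: complex) = (\<Sum>s<d. of_nat (?l m s))"
        using p unfolding homogeneous_poly_def by (metis of_nat_sum)
      then show "cst (of_nat n) * (cst (?l p m) * (\<Prod>i<d. z i ^ ?l m i))
          = (\<Sum>s<d. cst (of_nat (?l m s)) * (cst (?l p m) * (\<Prod>i<d. z i ^ ?l m i)))"
        by (simp only: scale_sum_left)
    qed
    also have "\<dots> = (\<Sum>s<d. \<Sum>m\<in>Poly_Mapping.keys p. cst (of_nat (?l m s)) * (cst (?l p m) * (\<Prod>i<d. z i ^ ?l m i)))"
      by (rule sum.swap)
    also have "\<dots> = (\<Sum>s<d. q s)"
      unfolding q_def by (intro sum.cong refl) (simp add: prod_power_remove mult_ac)
    finally show ?thesis .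
  qed
  \<comment> \<open>The left side carries the \<open>n\<^sup>2\<close> that cancels the price of
    \<open>bnd_Euler\<close>. Cauchy-Schwarz gives one factor \<open>d\<close>, the number of
    summands the other.\<close>
  then have "(real n)\<^sup>2 * nsq (subst_poly d p z * f) = nsq (\<Sum>s<d. cst (of_real 1) * (q s * f))"
    using nsq_scale[of "of_nat n" "subst_poly d p z * f"]
    by (simp add: sum_distrib_right flip: mult.assoc)
  also have "\<dots> \<le> (\<Sum>s<d. 1\<^sup>2) * (\<Sum>s<d. nsq (q s * f))"
    by (rule nsq_weighted_sum_le) simp
  also have "\<dots> = real d * (\<Sum>s<d. nsq (q s * f))"
    by simp
  also have "\<dots> \<le> real d * (\<Sum>s<d. (real n)\<^sup>2 * ?K * nsq f)"
    using bnd_q unfolding bnd_def by (intro mult_left_mono sum_mono) auto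
  also have "\<dots> = (real n)\<^sup>2 * ((real d)\<^sup>2 * ?K * nsq f)"
    by (simp add: power2_eq_square)
  finally show "nsq (subst_poly d p z * f) \<le> (real d)\<^sup>2 * ?K * nsq f"
    using n by (simp only: mult_le_cancel_left_pos zero_less_power of_nat_0_less_iff)
qed

end

section \<open>The polynomial ring acting on the orbit of a vector\<close>

definition poly_const :: "complex \<Rightarrow> cpoly" where
  "poly_const = Poly_Mapping.single 0"

definition poly_var :: "nat \<Rightarrow> cpoly" where
  "poly_var i = Poly_Mapping.single (Poly_Mapping.single i 1) 1"

lemma poly_mapping_eq_sum_single:
  "(\<Sum>k\<in>Poly_Mapping.keys p. Poly_Mapping.single k (Poly_Mapping.lookup p k)) = p"
proof (rule poly_mapping_eqI)
  fix k
  have "(\<Sum>x\<in>Poly_Mapping.keys p. Poly_Mapping.lookup (Poly_Mapping.single x (Poly_Mapping.lookup p x)) k)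
      = (\<Sum>x\<in>Poly_Mapping.keys p. if x = k then Poly_Mapping.lookup p k else 0)"
    by (intro sum.cong) (auto simp: lookup_single when_def)
  then show "Poly_Mapping.lookup (\<Sum>k\<in>Poly_Mapping.keys p. Poly_Mapping.single k (Poly_Mapping.lookup p k)) k
      = Poly_Mapping.lookup p k"
    by (simp add: lookup_sum in_keys_iff)
qed

lemma poly_var_power: "poly_var i ^ k = Poly_Mapping.single (Poly_Mapping.single i k) 1"
  by (induction k) (simp_all add: poly_var_def mult_single flip: single_add)

lemma prod_poly_var:
  "(\<Prod>i\<in>I. poly_var i ^ k i) = Poly_Mapping.single (\<Sum>i\<in>I. Poly_Mapping.single i (k i)) 1"
  by (induction I rule: infinite_finite_induct) (simp_all add: poly_var_power mult_single)

text \<open>Homogeneity confines the keys of every exponent to \<open>{..<d}\<close>, so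
  substituting the variables into \<open>p\<close> gives back \<open>p\<close>.\<close>

lemma homogeneous_poly_expand:
  assumes "homogeneous_poly d n p"
  shows "(\<Sum>m\<in>Poly_Mapping.keys p. poly_const (Poly_Mapping.lookup p m) *
      (\<Prod>i<d. poly_var i ^ Poly_Mapping.lookup m i)) = p"
proof -
  have "(\<Sum>i<d. Poly_Mapping.single i (Poly_Mapping.lookup m i)) = m" if "m \<in> Poly_Mapping.keys p" for m
  proof -
    have "(\<Sum>i<d. Poly_Mapping.single i (Poly_Mapping.lookup m i))
        = (\<Sum>i\<in>Poly_Mapping.keys m. Poly_Mapping.single i (Poly_Mapping.lookup m i))"
      using that assms by (intro sum.mono_neutral_right) (auto simp: homogeneous_poly_def in_keys_iff)
    then show ?thesis by (simp add: poly_mapping_eq_sum_single)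
  qed
  then have "(\<Sum>m\<in>Poly_Mapping.keys p. poly_const (Poly_Mapping.lookup p m) *
      (\<Prod>i<d. poly_var i ^ Poly_Mapping.lookup m i))
      = (\<Sum>m\<in>Poly_Mapping.keys p. Poly_Mapping.single m (Poly_Mapping.lookup p m))"
    by (simp add: poly_const_def prod_poly_var mult_single)
  then show ?thesis by (simp add: poly_mapping_eq_sum_single)
qed

lemma poly_const_simps:
  "poly_const 1 = 1" "poly_const (a + b) = poly_const a + poly_const b"
  "poly_const (a * b) = poly_const a * poly_const b"
  by (simp_all add: poly_const_def single_add mult_single)

lemma poly_const_mult_lookup: "Poly_Mapping.lookup (poly_const c * f) m = c * Poly_Mapping.lookup f m"
  unfolding poly_const_def mult_map_scale_conv_mult[symmetric]
  by (simp add: Poly_Mapping.map.rep_eq when_def)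

text \<open>The extra \<open>T i\<close> is moved outward past the powers of the later operators.
  Commutation is known only on \<open>D\<close>, so membership in \<open>D\<close> is carried
  through the induction.\<close>

lemma monomial_op_add_single:
  assumes comm: "\<And>i j y. \<lbrakk>i < d; j < d; y \<in> D\<rbrakk> \<Longrightarrow> T i (T j y) = T j (T i y)"
    and D: "\<And>i y. \<lbrakk>i < d; y \<in> D\<rbrakk> \<Longrightarrow> T i y \<in> D"
    and i: "i < d" and x: "x \<in> D"
  shows "e \<le> d \<Longrightarrow> monomial_op T m e x \<in> D \<and>
    monomial_op T (Poly_Mapping.single i 1 + m) e x
      = (if i < e then T i (monomial_op T m e x) else monomial_op T m e x)"
proof (induction e)
  case (Suc e)
  have pow: "(T e ^^ k) y \<in> D \<and> (T e ^^ k) (T i y) = T i ((T e ^^ k) y)" if "y \<in> D" for k y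
    using that i Suc.prems by (induction k) (auto simp: D comm)
  show ?case
    using Suc pow[of "monomial_op T m e x"] i
    by (auto simp: lookup_add lookup_single when_def funpow_swap1 less_Suc_eq)
qed (simp add: x)

context complex_hilbert_space
begin

context
  fixes d T x
  assumes T: "commuting_contractions H d T" and x: "x \<in> carrier H"
begin

lemma lin_T: "i < d \<Longrightarrow> linear_contraction (T i)"
  using T by (auto simp: commuting_contractions_def contraction_iff)

lemma monomial_closed [simp]: "monomial_op T m d x \<in> carrier H"
  using lin_T x by (intro linear_contractionD(1)[OF linear_contraction_monomial])

lemma poly_op_closed [simp]: "poly_op H d f T x \<in> carrier H"
  by (rule poly_op_bound(1)[OF T x])

lemma poly_op_superset:
  assumes "finite A" "Poly_Mapping.keys f \<subseteq> A"
  shows "poly_op H d f T x = (\<Oplus>m\<in>A. Poly_Mapping.lookup f m \<odot> monomial_op T m d x)"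
  unfolding poly_op_def using assms
  by (intro M.add.finprod_mono_neutral_cong_left) (auto simp: in_keys_iff)

lemma poly_op_add: "poly_op H d (f + g) T x = poly_op H d f T x \<oplus> poly_op H d g T x"
proof -
  let ?A = "Poly_Mapping.keys f \<union> Poly_Mapping.keys g"
  have "poly_op H d (f + g) T x
      = (\<Oplus>m\<in>?A. Poly_Mapping.lookup f m \<odot> monomial_op T m d x \<oplus> Poly_Mapping.lookup g m \<odot> monomial_op T m d x)"
    by (subst poly_op_superset[of ?A])
      (auto simp: keys_add lookup_add smult_l_distr[unfolded complex_field_simps, OF UNIV_I UNIV_I]
        intro!: M.finsum_cong')
  also have "\<dots> = poly_op H d f T x \<oplus> poly_op H d g T x"
    by (subst M.finsum_addf) (auto simp: poly_op_superset[of ?A f] poly_op_superset[of ?A g])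
  finally show ?thesis .
qed

lemma poly_op_const: "poly_op H d (poly_const c * f) T x = c \<odot> poly_op H d f T x"
proof -
  let ?A = "Poly_Mapping.keys f"
  have "poly_op H d (poly_const c * f) T x
      = (\<Oplus>m\<in>?A. c \<odot> (Poly_Mapping.lookup f m \<odot> monomial_op T m d x))"
    by (subst poly_op_superset[of ?A])
      (auto simp: in_keys_iff poly_const_mult_lookup
        smult_assoc1[unfolded complex_field_simps, OF UNIV_I UNIV_I] intro!: M.finsum_cong')
  also have "\<dots> = c \<odot> poly_op H d f T x"
    unfolding poly_op_def by (subst finsum_smult_ldistr) auto
  finally show ?thesis .
qed

lemma poly_op_single: "poly_op H d (Poly_Mapping.single m c) T x = c \<odot> monomial_op T m d x"
  by (subst poly_op_superset[of "{m}"]) (auto simp: M.finsum_insert)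

lemma poly_op_sum_var:
  assumes i: "i < d" and "finite A"
  shows "poly_op H d (poly_var i * (\<Sum>m\<in>A. Poly_Mapping.single m (c m))) T x
    = T i (poly_op H d (\<Sum>m\<in>A. Poly_Mapping.single m (c m)) T x)"
  using assms(2)
proof (induction A rule: finite_induct)
  case empty
  have "poly_op H d 0 T x = \<zero>" by (simp add: poly_op_def)
  moreover have "T i (0 \<odot> x) = 0 \<odot> T i x"
    using lin_T[OF i] x by (rule linear_contractionD)
  ultimately show ?case using x linear_contractionD(1)[OF lin_T[OF i] x] by simp
next
  case (insert m A)
  have "monomial_op T (Poly_Mapping.single i 1 + m) d x = T i (monomial_op T m d x)"
    using monomial_op_add_single[of d "carrier H" T i x d m] T x i linear_contractionD(1)[OF lin_T]
    by (simp add: commuting_contractions_def)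
  then have "poly_op H d (poly_var i * Poly_Mapping.single m (c m)) T x = T i (c m \<odot> monomial_op T m d x)"
    using linear_contractionD(3)[OF lin_T[OF i] monomial_closed]
    by (simp add: poly_var_def mult_single poly_op_single)
  then show ?case
    using insert by (simp add: distrib_left poly_op_add poly_op_single linear_contractionD(2)[OF lin_T[OF i]])
qed

lemma poly_op_var: "i < d \<Longrightarrow> poly_op H d (poly_var i * f) T x = T i (poly_op H d f T x)"
  using poly_op_sum_var[of i "Poly_Mapping.keys f" "Poly_Mapping.lookup f"]
  by (simp add: poly_mapping_eq_sum_single)

text \<open>Pullback of the inner product along the evaluation of polynomials at \<open>T\<close>
  and \<open>x\<close>; it degenerates where a nonzero polynomial kills \<open>x\<close>.\<close>

definition orbit_form :: "cpoly \<Rightarrow> cpoly \<Rightarrow> complex" where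
  "orbit_form f g = cinner H (poly_op H d f T x) (poly_op H d g T x)"

lemma algebra_form_orbit: "algebra_form poly_const orbit_form"
proof (unfold_locales, goal_cases)
  case (7 f g)
  show ?case unfolding orbit_form_def by (intro cinner_commute) auto
next
  case (8 f)
  show ?case unfolding orbit_form_def by (subst cinner_self) auto
qed (auto simp: orbit_form_def poly_op_add poly_op_const cinner_add_left cinner_smult_left
    distrib_left distrib_right poly_const_simps mult.assoc)

interpretation orbit: algebra_form poly_const orbit_form
  by (rule algebra_form_orbit)

lemma nsq_orbit: "orbit.nsq f = (hnorm H (poly_op H d f T x))\<^sup>2"
  unfolding orbit.nsq_def orbit_form_def by (subst cinner_self) auto

lemma hnorm_poly_op_le:
  assumes n: "n > 0" and p: "homogeneous_poly d n p" and d: "d \<ge> 3"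
  shows "hnorm H (poly_op H d p T x)
    \<le> 2 * real d * (\<Sum>u\<le>n. (inv_sqrt_coeff u)\<^sup>2) ^ (d - 3) * polydisc_norm d p * hnorm H x"
proof -
  let ?S = "\<Sum>u\<le>n. (inv_sqrt_coeff u)\<^sup>2"
  have "orbit.contractive (poly_var i)" if "i < d" for i
    using linear_contractionD(1,4)[OF lin_T[OF that]]
    by (auto simp: orbit.bnd_def nsq_orbit poly_op_var that intro!: power_mono)
  then have "orbit.bnd ((real d)\<^sup>2 * ((?S\<^sup>2) ^ (d - 3) * (4 * (polydisc_norm d p)\<^sup>2)))
      (orbit.subst_poly d p poly_var)"
    using d by (intro orbit.bnd_homogeneous[OF n p]) auto
  \<comment> \<open>The polynomial \<open>1\<close> stands for \<open>x\<close>, and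
    \<open>p * 1\<close> for \<open>p(T) x\<close>.\<close>
  then have "orbit.nsq (p * 1) \<le> (real d)\<^sup>2 * ((?S\<^sup>2) ^ (d - 3) * (4 * (polydisc_norm d p)\<^sup>2)) * orbit.nsq 1"
    unfolding orbit.subst_poly_def homogeneous_poly_expand[OF p] orbit.bnd_def by blast
  also have "\<dots> = (2 * real d * ?S ^ (d - 3) * polydisc_norm d p)\<^sup>2 * orbit.nsq 1"
    by (simp add: power_mult_distrib mult_ac flip: power_mult)
  finally have "(hnorm H (poly_op H d p T x))\<^sup>2
      \<le> (2 * real d * ?S ^ (d - 3) * polydisc_norm d p * hnorm H (poly_op H d 1 T x))\<^sup>2"
    by (simp add: nsq_orbit power_mult_distrib)
  moreover have "poly_op H d 1 T x = x"
  proof -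
    have "monomial_op T 0 e y = y" for e y by (induction e) auto
    then show ?thesis
      using poly_op_single[of 0 1] x by (simp add: single_one)
  qed
  moreover have "0 \<le> 2 * real d * ?S ^ (d - 3) * polydisc_norm d p * hnorm H x"
    using polydisc_norm_nonneg[of d p] x by (simp add: sum_nonneg)
  ultimately show ?thesis
    by (simp only: power2_le_imp_le)
qed

end

end

section \<open>The bound on the von Neumann constant\<close>

lemma vN_C_le:
  assumes d: "d \<ge> 3" and n: "n \<ge> 1"
  shows "vN_C d n \<le> 2 * real d * (\<Sum>u\<le>n. (inv_sqrt_coeff u)\<^sup>2) ^ (d - 3)"
proof (rule vN_C_least)
  let ?K = "2 * real d * (\<Sum>u\<le>n. (inv_sqrt_coeff u)\<^sup>2) ^ (d - 3)"
  show "vN_constant TYPE(nat set) d n ?K"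
    unfolding vN_constant_def
  proof (intro allI impI)
    fix H :: "nat set inner_space" and T p
    assume "complex_hilbert_space H" and T: "commuting_contractions H d T"
      and p: "homogeneous_poly d n p"
    then interpret complex_hilbert_space H by simp
    show "op_norm H (poly_op H d p T) \<le> ?K * polydisc_norm d p"
    proof (rule op_norm_le)
      fix x assume x: "x \<in> carrier H" "hnorm H x \<le> 1"
      have "hnorm H (poly_op H d p T x) \<le> ?K * polydisc_norm d p * hnorm H x"
        using n by (intro hnorm_poly_op_le[OF T x(1) _ p d]) simp
      also have "\<dots> \<le> ?K * polydisc_norm d p * 1"
        using x polydisc_norm_nonneg[of d p] by (intro mult_left_mono) (simp_all add: sum_nonneg)
      finally show "hnorm H (poly_op H d p T x) \<le> ?K * polydisc_norm d p" by simp
    qed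
  qed
qed (use d in simp)

theorem theorem1p1:
  shows "(\<forall>d\<ge>3. \<exists>c>0. \<forall>n\<ge>1. vN_C d n \<le> c * ln (real (n + 1)) ^ (d - 3)) \<and>
         bdd_above (vN_C 3 ` {1..})"
proof (intro conjI allI impI)
  fix d :: nat assume d: "d \<ge> 3"
  have "vN_C d n \<le> 2 * real d * 3 ^ (d - 3) * ln (real (n + 1)) ^ (d - 3)" if "n \<ge> 1" for n
  proof -
    have "vN_C d n \<le> 2 * real d * (\<Sum>u\<le>n. (inv_sqrt_coeff u)\<^sup>2) ^ (d - 3)"
      using d that by (rule vN_C_le)
    also have "\<dots> \<le> 2 * real d * (3 * ln (real (n + 1))) ^ (d - 3)"
      using that by (intro mult_left_mono power_mono sum_inv_sqrt_coeff_sq_le sum_nonneg) auto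
    finally show ?thesis by (simp add: power_mult_distrib mult.assoc)
  qed
  then show "\<exists>c>0. \<forall>n\<ge>1. vN_C d n \<le> c * ln (real (n + 1)) ^ (d - 3)"
    using d by (intro exI[of _ "2 * real d * 3 ^ (d - 3)"]) auto
next
  show "bdd_above (vN_C 3 ` {1..})"
    \<comment> \<open>For \<open>d = 3\<close> the exponent is 0, which leaves
      \<open>2 * 3\<close>.\<close>
    using vN_C_le[of 3] by (intro bdd_aboveI2[of _ _ 6]) simp
qed

end
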